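(* Let $G$ be a sofic group. Then $\mathrm{Pol}_2(G)$ is sofic.
   Context: For groups $G,H$, a map $f:G\to H$ and $g\in G$, define $\partial_g f:G\to H$ by $(\partial_g f)(x)=f(gx)f(x)^{-1}$, and put $\partial_{g_1,\ldots,g_k}f=\partial_{g_1}(\partial_{g_2}(\cdots\partial_{g_k}f))$. Universal polynomial group: for $s\ge1$, let $F_G$ be the free group on the symbols $\{x_g : g\in G\setminus\{1\}\}$, set $x_1=1$, and let $\iota:G\to F_G$, $\iota(g)=x_g$. Let $R_s(G)$ be the normal closure in $F_G$ of all elements $(\partial_{g_1,\ldots,g_{s+1}}\iota)(1)$, $g_1,\ldots,g_{s+1}\in G$. Then $\mathrm{Pol}_s(G)=F_G/R_s(G)$; here $s=2$. $\mathrm{Sym}(n)$ carries the normalized Hamming distance $d_n(\sigma,\tau)=1-\frac1n|\mathrm{Fix}(\sigma^{-1}\tau)|$. Soficity is defined for countable groups: a countable group $\Gamma$ is sofic if there is a sequence of maps $f_n:\Gamma\to\mathrm{Sym}(m_n)$ ($m_n$ positive integers) with $\lim_n d_{m_n}(f_n(gh),f_n(g)f_n(h))=0$ for all $g,h\in \Gamma$ and $\lim_n d_{m_n}(f_n(g),\mathrm{id})=1$ for every $g\ne1$. In particular a sofic group is countable by convention. *)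

theory Defs
  imports "HOL-Algebra.Algebra" "HOL-Library.Countable_Set"
begin

section \<open>Free groups\<close>

text \<open>
  The free group on a set \<open>S\<close>, in the reduced-word model. A letter \<open>(a, True)\<close> stands for the
  generator of \<open>a\<close> and \<open>(a, False)\<close> for its inverse; a word is reduced if no letter is adjacent
  to its inverse.
\<close>

definition reduced_word :: "('a \<times> bool) list \<Rightarrow> bool" where
  "reduced_word = successively (\<lambda>(a, d) (b, e). a = b \<longrightarrow> d = e)"

fun push_letter :: "'a \<times> bool \<Rightarrow> ('a \<times> bool) list \<Rightarrow> ('a \<times> bool) list" where
  "push_letter x [] = [x]"
| "push_letter (a, d) ((b, e) # w) = (if a = b \<and> d \<noteq> e then w else (a, d) # (b, e) # w)"

definition free_group :: "'a set \<Rightarrow> ('a \<times> bool) list monoid" where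
  "free_group S = \<lparr>carrier = {w \<in> lists (S \<times> UNIV). reduced_word w},
     monoid.mult = (\<lambda>u v. foldr push_letter u v), one = []\<rparr>"

definition free_gen :: "'a \<Rightarrow> ('a \<times> bool) list" where
  "free_gen a = [(a, True)]"

lemma reduced_Nil: "reduced_word []"
  by (simp add: reduced_word_def)

lemma reduced_push: "reduced_word w \<Longrightarrow> reduced_word (push_letter x w)"
  by (induction x w rule: push_letter.induct)
    (auto simp: reduced_word_def successively_Cons split: if_splits)

lemma reduced_Cons_push: "reduced_word (x # w) \<Longrightarrow> push_letter x w = x # w"
  by (cases "(x, w)" rule: push_letter.cases) (auto simp: reduced_word_def)

lemma reduced_tl: "reduced_word (x # w) \<Longrightarrow> reduced_word w"
  by (auto simp: reduced_word_def successively_Cons)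

lemma push_cancel:
  assumes "reduced_word w" "d \<noteq> e"
  shows "push_letter (a, d) (push_letter (a, e) w) = w"
proof (cases w)
  case Nil
  then show ?thesis using assms by simp
next
  case (Cons y v)
  obtain b c where y: "y = (b, c)" by (cases y)
  show ?thesis
  proof (cases "a = b \<and> e \<noteq> c")
    case True
    then have "c = d" using assms by auto
    then show ?thesis
      using True Cons y assms reduced_Cons_push[of y v] by auto
  next
    case False
    then show ?thesis using Cons y assms by auto
  qed
qed

lemma push_in: "x \<in> S \<times> UNIV \<Longrightarrow> w \<in> lists (S \<times> UNIV) \<Longrightarrow> push_letter x w \<in> lists (S \<times> UNIV)"
  by (induction x w rule: push_letter.induct) auto

lemma foldr_push_in:
  "u \<in> lists (S \<times> UNIV) \<Longrightarrow> w \<in> lists (S \<times> UNIV) \<Longrightarrow> foldr push_letter u w \<in> lists (S \<times> UNIV)"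
proof (induction u)
  case (Cons x u)
  then show ?case using push_in[of x S "foldr push_letter u w"] by simp
qed simp

lemma reduced_foldr: "reduced_word w \<Longrightarrow> reduced_word (foldr push_letter u w)"
  by (induction u) (auto intro: reduced_push)

lemma foldr_push_assoc:
  assumes "reduced_word v" "reduced_word w"
  shows "foldr push_letter (foldr push_letter u v) w = foldr push_letter u (foldr push_letter v w)"
proof (induction u)
  case (Cons x u)
  define t where "t = foldr push_letter u v"
  have "foldr push_letter (push_letter x t) w = push_letter x (foldr push_letter t w)"
  proof (cases "(x, t)" rule: push_letter.cases)
    case (2 a d b e r)
    then show ?thesis
      using push_cancel[of "foldr push_letter r w" d e a] reduced_foldr[OF assms(2)] by auto
  qed auto
  then show ?case using Cons by (simp add: t_def)
qed simp

lemma foldr_push_Nil: "reduced_word u \<Longrightarrow> foldr push_letter u [] = u"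
proof (induction u)
  case (Cons x u)
  then show ?case using reduced_tl[of x u] reduced_Cons_push[of x u] by simp
qed simp

lemma free_group_left_inverse:
  "u \<in> lists (S \<times> UNIV) \<Longrightarrow>
    \<exists>v \<in> lists (S \<times> UNIV). reduced_word v \<and> (\<forall>w. reduced_word w \<longrightarrow> foldr push_letter v (foldr push_letter u w) = w)"
proof (induction u)
  case Nil
  then show ?case by (intro bexI[of _ "[]"]) (auto simp: reduced_word_def)
next
  case (Cons x u)
  then obtain v where v: "v \<in> lists (S \<times> UNIV)" "reduced_word v"
    "\<And>w. reduced_word w \<Longrightarrow> foldr push_letter v (foldr push_letter u w) = w" by auto
  obtain a d where x: "x = (a, d)" by (cases x)
  let ?y = "(a, \<not> d)"
  let ?v = "foldr push_letter v [?y]"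
  have r: "reduced_word [?y]" by (simp add: reduced_word_def)
  have "foldr push_letter ?v (foldr push_letter (x # u) w) = w" if w: "reduced_word w" for w
  proof -
    have "foldr push_letter ?v (foldr push_letter (x # u) w) =
        foldr push_letter v (push_letter ?y (push_letter x (foldr push_letter u w)))"
      using foldr_push_assoc[OF r, of "foldr push_letter (x # u) w" v] reduced_foldr[OF w, of "x # u"]
      by simp
    also have "\<dots> = w"
      using v(3)[OF w] push_cancel[of "foldr push_letter u w" "\<not> d" d a] reduced_foldr[OF w] x by simp
    finally show ?thesis .
  qed
  moreover have "?v \<in> lists (S \<times> UNIV)"
    using foldr_push_in[OF v(1), of "[?y]"] Cons.prems x by auto
  ultimately show ?case using reduced_foldr[OF r] by blast
qed

lemma group_free_group: "group (free_group S)"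
proof (rule groupI)
  fix x assume x: "x \<in> carrier (free_group S)"
  then obtain v where v: "v \<in> lists (S \<times> UNIV)" "reduced_word v"
    "\<And>w. reduced_word w \<Longrightarrow> foldr push_letter v (foldr push_letter x w) = w"
    using free_group_left_inverse[of x S] by (auto simp: free_group_def)
  have "foldr push_letter v x = []"
    using v(3)[of "[]"] foldr_push_Nil[of x] x by (auto simp: free_group_def reduced_word_def)
  with v show "\<exists>y\<in>carrier (free_group S). y \<otimes>\<^bsub>free_group S\<^esub> x = \<one>\<^bsub>free_group S\<^esub>"
    by (intro bexI[of _ v]) (auto simp: free_group_def)
next
  fix x y assume "x \<in> carrier (free_group S)" "y \<in> carrier (free_group S)"
  then show "x \<otimes>\<^bsub>free_group S\<^esub> y \<in> carrier (free_group S)"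
    using foldr_push_in[of x S y] reduced_foldr[of y x] by (simp add: free_group_def)
qed (auto simp: free_group_def reduced_Nil foldr_push_assoc)

lemma free_gen_closed: "a \<in> S \<Longrightarrow> free_gen a \<in> carrier (free_group S)"
  by (simp add: free_gen_def free_group_def reduced_word_def)

theorem free_group_universal:
  assumes "group H" and \<phi>: "\<phi> \<in> S \<rightarrow> carrier H"
  shows "\<exists>h \<in> hom (free_group S) H. \<forall>a\<in>S. h (free_gen a) = \<phi> a"
proof -
  interpret H: group H by fact
  define l where "l = (\<lambda>(a, e). if e then \<phi> a else inv\<^bsub>H\<^esub> \<phi> a)"
  define h where "h = (\<lambda>w. foldr (\<lambda>x y. l x \<otimes>\<^bsub>H\<^esub> y) w \<one>\<^bsub>H\<^esub>)"
  have l: "l x \<in> carrier H" if "x \<in> S \<times> UNIV" for x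
    using that Pi_mem[OF \<phi>] by (auto simp: l_def)
  have h: "h w \<in> carrier H" if "w \<in> lists (S \<times> UNIV)" for w
    using that by (induction w) (use l in \<open>auto simp: h_def\<close>)
  have p: "h (push_letter x w) = l x \<otimes>\<^bsub>H\<^esub> h w"
    if "x \<in> S \<times> UNIV" "w \<in> lists (S \<times> UNIV)" for x w
  proof (cases "(x, w)" rule: push_letter.cases)
    case (2 a d b e r)
    have r: "h r \<in> carrier H" using that 2 by (intro h) auto
    have "\<phi> a \<in> carrier H" using that 2 Pi_mem[OF \<phi>] by auto
    then have "l (a, d) \<otimes>\<^bsub>H\<^esub> (l (a, e) \<otimes>\<^bsub>H\<^esub> h r) = h r" if "d \<noteq> e"
      using r that by (auto simp: l_def H.m_assoc[symmetric])
    then show ?thesis using 2 by (auto simp: h_def)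
  qed (auto simp: h_def)
  have m: "h (foldr push_letter u w) = h u \<otimes>\<^bsub>H\<^esub> h w"
    if "u \<in> lists (S \<times> UNIV)" "w \<in> lists (S \<times> UNIV)" for u w
    using that(1)
  proof (induction u)
    case Nil
    then show ?case using h[OF that(2)] by (simp add: h_def)
  next
    case (Cons x u)
    have e: "h (x # u) = l x \<otimes>\<^bsub>H\<^esub> h u" by (simp add: h_def)
    have c: "l x \<in> carrier H" "h u \<in> carrier H" "h w \<in> carrier H"
      using l[OF Cons.hyps(1)] h[OF Cons.hyps(2)] h[OF that(2)] by auto
    have "h (foldr push_letter (x # u) w) = l x \<otimes>\<^bsub>H\<^esub> h (foldr push_letter u w)"
      using p[OF Cons.hyps(1) foldr_push_in[OF Cons.hyps(2) that(2)]] by simp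
    with Cons.IH e c show ?case by (simp add: H.m_assoc)
  qed
  have "h \<in> hom (free_group S) H"
    using h m by (intro homI) (auto simp: free_group_def simp del: in_lists_conv_set lists_eq_set)
  moreover have "\<forall>a\<in>S. h (free_gen a) = \<phi> a"
    using Pi_mem[OF \<phi>] by (auto simp: h_def l_def free_gen_def)
  ultimately show ?thesis by blast
qed


section \<open>The universal polynomial groups\<close>

definition normal_closure :: "('a, 'b) monoid_scheme \<Rightarrow> 'a set \<Rightarrow> 'a set" where
  "normal_closure G S = \<Inter>{N. N \<lhd> G \<and> S \<subseteq> N}"

lemma normal_normal_closure:
  assumes "group G" "S \<subseteq> carrier G"
  shows "normal_closure G S \<lhd> G"
proof -
  interpret group G by fact
  have "carrier G \<lhd> G" by (rule normal_self)
  with assms(2) have "{N. N \<lhd> G \<and> S \<subseteq> N} \<noteq> {}" by blast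
  then show ?thesis unfolding normal_closure_def
    by (intro normal_invI subgroups_Inter)
      (auto intro: normal_imp_subgroup normal.inv_op_closed2)
qed

definition group_diff ::
  "('a, 'b) monoid_scheme \<Rightarrow> ('c, 'd) monoid_scheme \<Rightarrow> 'a \<Rightarrow> ('a \<Rightarrow> 'c) \<Rightarrow> 'a \<Rightarrow> 'c" where
  "group_diff G H g f = (\<lambda>x. f (g \<otimes>\<^bsub>G\<^esub> x) \<otimes>\<^bsub>H\<^esub> inv\<^bsub>H\<^esub> (f x))"

text \<open>For \<open>gs = [g\<^sub>1, \<dots>, g\<^sub>k]\<close> this is \<open>\<partial>\<^bsub>g\<^sub>1\<^esub> (\<partial>\<^bsub>g\<^sub>2\<^esub> (\<dots> (\<partial>\<^bsub>g\<^sub>k\<^esub> f)))\<close>: the last entry acts first.\<close>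

definition group_diffs ::
  "('a, 'b) monoid_scheme \<Rightarrow> ('c, 'd) monoid_scheme \<Rightarrow> 'a list \<Rightarrow> ('a \<Rightarrow> 'c) \<Rightarrow> 'a \<Rightarrow> 'c" where
  "group_diffs G H gs f = foldr (group_diff G H) gs f"

definition pol_free :: "('a, 'b) monoid_scheme \<Rightarrow> ('a \<times> bool) list monoid" where
  "pol_free G = free_group (carrier G - {\<one>\<^bsub>G\<^esub>})"

definition pol_iota :: "('a, 'b) monoid_scheme \<Rightarrow> 'a \<Rightarrow> ('a \<times> bool) list" where
  "pol_iota G g = (if g = \<one>\<^bsub>G\<^esub> then \<one>\<^bsub>pol_free G\<^esub> else free_gen g)"

definition pol_relators :: "nat \<Rightarrow> ('a, 'b) monoid_scheme \<Rightarrow> ('a \<times> bool) list set" where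
  "pol_relators s G =
     {group_diffs G (pol_free G) gs (pol_iota G) \<one>\<^bsub>G\<^esub> | gs. gs \<in> lists (carrier G) \<and> length gs = s + 1}"

text \<open>The mathematical definition is only made for \<open>s \<ge> 1\<close>.\<close>

definition Pol :: "nat \<Rightarrow> ('a, 'b) monoid_scheme \<Rightarrow> ('a \<times> bool) list set monoid" where
  "Pol s G = pol_free G Mod normal_closure (pol_free G) (pol_relators s G)"

lemma pol_relators_closed:
  assumes "group G"
  shows "pol_relators s G \<subseteq> carrier (pol_free G)"
proof -
  interpret G: group G by fact
  interpret F: group "pol_free G" unfolding pol_free_def by (rule group_free_group)
  have "group_diffs G (pol_free G) gs (pol_iota G) x \<in> carrier (pol_free G)"
    if "gs \<in> lists (carrier G)" "x \<in> carrier G" for gs x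
    using that
  proof (induction gs arbitrary: x)
    case Nil
    then show ?case
      using free_gen_closed[of x "carrier G - {\<one>\<^bsub>G\<^esub>}"] F.one_closed
      by (auto simp: group_diffs_def pol_iota_def pol_free_def)
  next
    case (Cons g gs)
    then show ?case
      by (auto simp: group_diffs_def group_diff_def simp del: in_lists_conv_set lists_eq_set)
  qed
  then show ?thesis by (auto simp: pol_relators_def simp del: in_lists_conv_set lists_eq_set)
qed

lemma group_Pol: "group G \<Longrightarrow> group (Pol s G)"
  unfolding Pol_def
  by (intro normal.factorgroup_is_group normal_normal_closure pol_relators_closed)
    (simp_all add: pol_free_def group_free_group)


section \<open>Sofic groups\<close>

text \<open>
  \<open>sym_group n\<close> consists of permutations of the whole type \<open>nat\<close> that fix everything outside
  \<open>{1..n}\<close>, so fixed points have to be counted inside \<open>{1..n}\<close>.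
\<close>

definition hamming_dist :: "nat \<Rightarrow> (nat \<Rightarrow> nat) \<Rightarrow> (nat \<Rightarrow> nat) \<Rightarrow> real" where
  "hamming_dist n \<sigma> \<tau> =
     1 - real (card {i \<in> {1..n}. (inv\<^bsub>sym_group n\<^esub> \<sigma> \<otimes>\<^bsub>sym_group n\<^esub> \<tau>) i = i}) / real n"

definition sofic :: "('a, 'b) monoid_scheme \<Rightarrow> bool" where
  "sofic \<Gamma> \<longleftrightarrow> group \<Gamma> \<and> countable (carrier \<Gamma>) \<and>
     (\<exists>(m :: nat \<Rightarrow> nat) (f :: nat \<Rightarrow> 'a \<Rightarrow> nat \<Rightarrow> nat).
        (\<forall>n. m n > 0 \<and> f n \<in> carrier \<Gamma> \<rightarrow> carrier (sym_group (m n))) \<and>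
        (\<forall>g \<in> carrier \<Gamma>. \<forall>h \<in> carrier \<Gamma>.
           (\<lambda>n. hamming_dist (m n) (f n (g \<otimes>\<^bsub>\<Gamma>\<^esub> h)) (f n g \<otimes>\<^bsub>sym_group (m n)\<^esub> f n h))
             \<longlonglongrightarrow> 0) \<and>
        (\<forall>g \<in> carrier \<Gamma> - {\<one>\<^bsub>\<Gamma>\<^esub>}.
           (\<lambda>n. hamming_dist (m n) (f n g) \<one>\<^bsub>sym_group (m n)\<^esub>) \<longlonglongrightarrow> 1))"

end

theory Submission
  imports Defs
begin

text \<open>
  For a quadratic map \<open>f\<close> put \<open>c g h = f (hg) (f g)\<inverse> (f h)\<inverse>\<close>. Third differences vanish, so \<open>c\<close> is
  multiplicative in \<open>g\<close>; comparing two expansions of the second difference along \<open>hh'\<close> shows that all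
  values of \<open>c\<close> commute and that \<open>c g\<close> is a cocycle in \<open>h\<close>. Hence every element of \<open>Pol\<^sub>2(G)\<close> has the
  form \<open>c g\<^sub>1 h\<^sub>1 \<cdots> c g\<^sub>r h\<^sub>r \<cdot> f g\<close> with distinct \<open>h\<^sub>i \<noteq> 1\<close>, and \<open>c g\<^sub>i h\<^sub>i\<close> only depends on the class of
  \<open>g\<^sub>i\<close> in the abelianization. For a homomorphism \<open>\<pi>\<close> from \<open>G\<close> to an abelian group \<open>B\<close>, the map
  \<open>g \<mapsto> (\<pi> g at position 1, g)\<close> into the restricted wreath product of \<open>B\<close> by \<open>G\<close> is quadratic, and the
  induced homomorphism sends \<open>c g h\<close> to the lamp configuration with \<open>\<pi> g\<close> at \<open>1\<close> and \<open>(\<pi> g)\<inverse>\<close> at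
  \<open>h\<close>. Every nontrivial element of an abelian group survives in a torsion quotient (divide by a
  maximal subgroup avoiding it), so \<open>Pol\<^sub>2(G)\<close> is residually a wreath product with torsion abelian
  lamps.

  Such wreath products are sofic: finitely many lamp values lie in a finite subgroup \<open>B'\<close> of \<open>B\<close>,
  and an approximation \<open>\<sigma>\<close> of \<open>G\<close> on \<open>\<Omega>\<close> yields the approximation
  \<open>(u, g) (\<phi>, x) = (\<phi> \<cdot> \<Prod>\<^sub>k u(k) at \<sigma>(k\<inverse>g) x, \<sigma>(g) x)\<close> on \<open>B'\<^bsup>\<Omega>\<^esup> \<times> \<Omega>\<close>. Finally, diagonal products of
  approximations separate finitely many elements at once.
\<close>


section \<open>Finite approximations by permutations\<close>

text \<open>A finite form of soficity: multiplicativity is tested on \<open>E\<close>, displacement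
  on \<open>D\<close>, and one exceptional set \<open>B\<close> of proportion at most \<epsilon>
  serves all tests at once. The set \<open>\<Omega>\<close> may have any type, so that products and
  function spaces can be used directly.\<close>

definition perm_approx ::
  "('a, 'b) monoid_scheme \<Rightarrow> 'a set \<Rightarrow> 'a set \<Rightarrow> real \<Rightarrow> 'x set \<Rightarrow> ('a \<Rightarrow> 'x \<Rightarrow> 'x) \<Rightarrow> bool" where
  "perm_approx \<Gamma> E D \<epsilon> \<Omega> \<rho> \<longleftrightarrow> finite \<Omega> \<and> \<Omega> \<noteq> {} \<and> (\<forall>g\<in>carrier \<Gamma>. bij_betw (\<rho> g) \<Omega> \<Omega>) \<and>
     (\<exists>B\<subseteq>\<Omega>. real (card B) \<le> \<epsilon> * real (card \<Omega>) \<and>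
        (\<forall>x\<in>\<Omega> - B. (\<forall>g\<in>E. \<forall>h\<in>E. \<rho> (g \<otimes>\<^bsub>\<Gamma>\<^esub> h) x = \<rho> g (\<rho> h x)) \<and> (\<forall>g\<in>D. \<rho> g x \<noteq> x)))"

text \<open>The model is normalised to \<open>{1..m}\<close> with permutations of the whole type
  \<open>nat\<close>, to match \<open>sym_group\<close>.\<close>

definition locally_sofic :: "('a, 'b) monoid_scheme \<Rightarrow> bool" where
  "locally_sofic \<Gamma> \<longleftrightarrow> (\<forall>E D. \<forall>\<epsilon>>0. finite E \<longrightarrow> finite D \<longrightarrow> E \<subseteq> carrier \<Gamma> \<longrightarrow> D \<subseteq> carrier \<Gamma> - {\<one>\<^bsub>\<Gamma>\<^esub>} \<longrightarrow>
     (\<exists>m > 0. \<exists>\<rho>. perm_approx \<Gamma> E D \<epsilon> {1..m::nat} \<rho> \<and> (\<forall>g\<in>carrier \<Gamma>. \<rho> g permutes {1..m})))"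

text \<open>Conjugate by an enumeration of \<open>\<Omega>\<close> and extend by the identity
  outside \<open>{1..m}\<close>; all counts and all equations are preserved.\<close>

lemma perm_approx_transport:
  fixes \<Omega> :: "'x set"
  assumes a: "perm_approx \<Gamma> E D \<epsilon> \<Omega> \<rho>" and cl: "group \<Gamma>" "E \<subseteq> carrier \<Gamma>" "D \<subseteq> carrier \<Gamma>"
  shows "\<exists>m > 0. \<exists>\<rho>'. perm_approx \<Gamma> E D \<epsilon> {1..m::nat} \<rho>' \<and> (\<forall>g\<in>carrier \<Gamma>. \<rho>' g permutes {1..m})"
proof -
  interpret group \<Gamma> by fact
  define m where "m = card \<Omega>"
  have fin: "finite \<Omega>" "\<Omega> \<noteq> {}" and bij: "\<And>g. g \<in> carrier \<Gamma> \<Longrightarrow> bij_betw (\<rho> g) \<Omega> \<Omega>"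
    using a by (auto simp: perm_approx_def)
  obtain B where B: "B \<subseteq> \<Omega>" "real (card B) \<le> \<epsilon> * real (card \<Omega>)"
    "\<And>x g h. x \<in> \<Omega> - B \<Longrightarrow> g \<in> E \<Longrightarrow> h \<in> E \<Longrightarrow> \<rho> (g \<otimes>\<^bsub>\<Gamma>\<^esub> h) x = \<rho> g (\<rho> h x)"
    "\<And>x g. x \<in> \<Omega> - B \<Longrightarrow> g \<in> D \<Longrightarrow> \<rho> g x \<noteq> x"
    using a unfolding perm_approx_def by metis
  have "m > 0" using fin by (simp add: m_def card_gt_0_iff)
  obtain b where b: "bij_betw b \<Omega> {1..m}"
    using fin by (metis m_def ex_bij_betw_nat_finite_1 bij_betw_the_inv_into)
  define c where "c = inv_into \<Omega> b"
  have c: "bij_betw c {1..m} \<Omega>" using b by (simp add: c_def bij_betw_inv_into)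
  have bc: "\<And>i. i \<in> {1..m} \<Longrightarrow> b (c i) = i" and cb: "\<And>x. x \<in> \<Omega> \<Longrightarrow> c (b x) = x"
    using b by (auto simp: c_def bij_betw_inv_into_right bij_betw_inv_into_left)
  have cX: "\<And>i. i \<in> {1..m} \<Longrightarrow> c i \<in> \<Omega>" and bX: "\<And>x. x \<in> \<Omega> \<Longrightarrow> b x \<in> {1..m}"
    using b c by (auto simp: bij_betw_def)
  define \<rho>' where "\<rho>' g i = (if i \<in> {1..m} then b (\<rho> g (c i)) else i)" for g i
  have \<rho>\<Omega>: "\<And>g x. g \<in> carrier \<Gamma> \<Longrightarrow> x \<in> \<Omega> \<Longrightarrow> \<rho> g x \<in> \<Omega>"
    using bij by (auto simp: bij_betw_def)
  have bij': "bij_betw (\<rho>' g) {1..m} {1..m}" if "g \<in> carrier \<Gamma>" for g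
  proof -
    have "bij_betw (b \<circ> (\<rho> g \<circ> c)) {1..m} {1..m}"
      using b c bij[OF that] by (blast intro: bij_betw_trans)
    then show ?thesis by (subst bij_betw_cong[where g = "b \<circ> (\<rho> g \<circ> c)"]) (auto simp: \<rho>'_def)
  qed
  have "\<rho>' g permutes {1..m}" if "g \<in> carrier \<Gamma>" for g
    using bij'[OF that] by (rule bij_imp_permutes) (auto simp: \<rho>'_def)
  moreover have "perm_approx \<Gamma> E D \<epsilon> {1..m} \<rho>'"
    unfolding perm_approx_def
  proof (intro conjI exI[of _ "b ` B"] ballI)
    show "b ` B \<subseteq> {1..m}" using B(1) bX by blast
    have "card (b ` B) = card B"
      using b B(1) by (intro card_image) (auto simp: bij_betw_def intro: inj_on_subset)
    then show "real (card (b ` B)) \<le> \<epsilon> * real (card {1..m})" using B(2) by (simp add: m_def)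
  next
    fix x g h assume *: "x \<in> {1..m} - b ` B" "g \<in> E" "h \<in> E"
    then have "c x \<in> \<Omega> - B" using cX bc by (metis Diff_iff imageI)
    with B(3) * cl have "\<rho> (g \<otimes>\<^bsub>\<Gamma>\<^esub> h) (c x) = \<rho> g (\<rho> h (c x))" "c x \<in> \<Omega>" "h \<in> carrier \<Gamma>" by auto
    then show "\<rho>' (g \<otimes>\<^bsub>\<Gamma>\<^esub> h) x = \<rho>' g (\<rho>' h x)"
      using * cb \<rho>\<Omega> bX by (auto simp: \<rho>'_def)
  next
    fix x g assume *: "x \<in> {1..m} - b ` B" "g \<in> D"
    then have "c x \<in> \<Omega> - B" using cX bc by (metis Diff_iff imageI)
    with B(4) * cl have "\<rho> g (c x) \<noteq> c x" "c x \<in> \<Omega>" "g \<in> carrier \<Gamma>" by auto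
    then show "\<rho>' g x \<noteq> x"
      using * cb[of "\<rho> g (c x)"] \<rho>\<Omega> by (auto simp: \<rho>'_def)
  qed (use \<open>m > 0\<close> bij' in auto)
  ultimately show ?thesis using \<open>m > 0\<close> by blast
qed

section \<open>Soficity in terms of finite approximations\<close>

lemma hamming_dist_permutes:
  assumes "\<sigma> permutes {1..n}" "\<tau> permutes {1..n}" "n > 0"
  shows "hamming_dist n \<sigma> \<tau> = real (card {i\<in>{1..n}. \<sigma> i \<noteq> \<tau> i}) / real n"
proof -
  define T where "T = {i\<in>{1..n}. \<sigma> i \<noteq> \<tau> i}"
  \<comment> \<open>The inverse of \<sigma> composed with \<tau> fixes \<open>i\<close> exactly when
    \<sigma> and \<tau> agree at \<open>i\<close>.\<close>
  have "{i \<in> {1..n}. (inv\<^bsub>sym_group n\<^esub> \<sigma> \<otimes>\<^bsub>sym_group n\<^esub> \<tau>) i = i} = {1..n} - T"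
    using assms by (auto simp: T_def sym_group_carrier sym_group_mult permutes_inverses inv_f_eq permutes_inj
        permutes_inv_eq)
  moreover have "T \<subseteq> {1..n}" by (auto simp: T_def)
  then have "card T \<le> n" "card ({1..n} - T) = n - card T"
    using card_mono[of "{1..n}" T] finite_subset[of T "{1..n}"] by (auto simp: card_Diff_subset)
  ultimately show ?thesis
    using assms(3) unfolding hamming_dist_def T_def[symmetric] by (simp add: of_nat_diff field_simps)
qed

text \<open>Finitely many limits are involved, so a single late index \<open>n\<close> makes every
  failure set small; their union is the exceptional set.\<close>

lemma sofic_imp_locally_sofic:
  assumes "sofic \<Gamma>"
  shows "locally_sofic \<Gamma>"
  unfolding locally_sofic_def
proof (intro allI impI)
  fix E D :: "'a set" and \<epsilon> :: real
  assume ED: "finite E" "finite D" "E \<subseteq> carrier \<Gamma>" "D \<subseteq> carrier \<Gamma> - {\<one>\<^bsub>\<Gamma>\<^esub>}" and \<epsilon>: "\<epsilon> > 0"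
  interpret group \<Gamma> using assms by (simp add: sofic_def)
  obtain m f where mf: "\<And>n. m n > (0::nat)" "\<And>n. f n \<in> carrier \<Gamma> \<rightarrow> carrier (sym_group (m n))"
    and lim1: "\<And>g h. g \<in> carrier \<Gamma> \<Longrightarrow> h \<in> carrier \<Gamma> \<Longrightarrow>
      (\<lambda>n. hamming_dist (m n) (f n (g \<otimes>\<^bsub>\<Gamma>\<^esub> h)) (f n g \<otimes>\<^bsub>sym_group (m n)\<^esub> f n h)) \<longlonglongrightarrow> 0"
    and lim2: "\<And>g. g \<in> carrier \<Gamma> - {\<one>\<^bsub>\<Gamma>\<^esub>} \<Longrightarrow>
      (\<lambda>n. hamming_dist (m n) (f n g) \<one>\<^bsub>sym_group (m n)\<^esub>) \<longlonglongrightarrow> 1"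
    using assms unfolding sofic_def by blast
  have p: "f n g permutes {1..m n}" if "g \<in> carrier \<Gamma>" for n g
    using Pi_mem[OF mf(2)[of n] that] by (simp only: sym_group_carrier)
  define M where "M g h n = {i\<in>{1..m n}. f n (g \<otimes>\<^bsub>\<Gamma>\<^esub> h) i \<noteq> f n g (f n h i)}" for g h n
  define L where "L g n = {i\<in>{1..m n}. f n g i = i}" for g n
  \<comment> \<open>The tolerance is shared among one failure set for each pair in
    \<open>E \<times> E\<close> and one for each element of \<open>D\<close>; the \<open>+ 1\<close>
    keeps the denominator positive when there are none.\<close>
  define \<delta> where "\<delta> = \<epsilon> / real (card (E \<times> E) + card D + 1)"
  have \<delta>: "\<delta> > 0" using \<epsilon> by (simp add: \<delta>_def)
  then have less1: "1 - \<delta> < 1" by simp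
  have "\<forall>\<^sub>F n in sequentially. real (card (M g h n)) \<le> \<delta> * real (m n)" if "g \<in> carrier \<Gamma>" "h \<in> carrier \<Gamma>" for g h
    using order_tendstoD(2)[OF lim1[OF that] \<delta>]
  proof eventually_elim
    case (elim n)
    have "hamming_dist (m n) (f n (g \<otimes>\<^bsub>\<Gamma>\<^esub> h)) (f n g \<circ> f n h) = real (card (M g h n)) / real (m n)"
      using that mf(1) by (subst hamming_dist_permutes) (auto simp: M_def p permutes_compose simp del: One_nat_def)
    with elim mf(1)[of n] show ?case by (simp add: sym_group_mult field_simps)
  qed
  then have ev1: "\<forall>\<^sub>F n in sequentially. \<forall>(g, h)\<in>E \<times> E. real (card (M g h n)) \<le> \<delta> * real (m n)"
    using ED by (intro eventually_ball_finite) auto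
  have "\<forall>\<^sub>F n in sequentially. real (card (L g n)) \<le> \<delta> * real (m n)" if "g \<in> carrier \<Gamma> - {\<one>\<^bsub>\<Gamma>\<^esub>}" for g
    using order_tendstoD(1)[OF lim2[OF that] less1]
  proof eventually_elim
    case (elim n)
    have *: "hamming_dist (m n) (f n g) id = real (card ({1..m n} - L g n)) / real (m n)"
      using that mf(1) by (subst hamming_dist_permutes) (auto simp: L_def p permutes_id simp del: One_nat_def intro!: arg_cong[where f = card])
    have "L g n \<subseteq> {1..m n}" by (auto simp: L_def)
    then have "card (L g n) \<le> m n" using card_mono[of "{1..m n}" "L g n"] by auto
    then have "hamming_dist (m n) (f n g) id = 1 - real (card (L g n)) / real (m n)"
      unfolding * using mf(1)[of n] by (subst card_Diff_subset) (auto simp: L_def of_nat_diff field_simps)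
    with elim mf(1)[of n] show ?case by (simp add: sym_group_one field_simps)
  qed
  then have ev2: "\<forall>\<^sub>F n in sequentially. \<forall>g\<in>D. real (card (L g n)) \<le> \<delta> * real (m n)"
    using ED by (intro eventually_ball_finite) auto
  obtain n where n1: "\<And>g h. g \<in> E \<Longrightarrow> h \<in> E \<Longrightarrow> real (card (M g h n)) \<le> \<delta> * real (m n)"
    and n2: "\<And>g. g \<in> D \<Longrightarrow> real (card (L g n)) \<le> \<delta> * real (m n)"
    using eventually_happens'[OF sequentially_bot eventually_conj[OF ev1 ev2]] by auto
  define B where "B = (\<Union>(g, h)\<in>E \<times> E. M g h n) \<union> (\<Union>g\<in>D. L g n)"
  have "real (card B) \<le> real (card (\<Union>(g, h)\<in>E \<times> E. M g h n) + card (\<Union>g\<in>D. L g n))"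
    unfolding B_def of_nat_le_iff by (rule card_Un_le)
  also have "\<dots> \<le> real ((\<Sum>(g, h)\<in>E \<times> E. card (M g h n)) + (\<Sum>g\<in>D. card (L g n)))"
    unfolding of_nat_le_iff using ED
    by (intro add_mono order.trans[OF card_UN_le]) (auto simp: case_prod_beta)
  also have "\<dots> = (\<Sum>(g, h)\<in>E \<times> E. real (card (M g h n))) + (\<Sum>g\<in>D. real (card (L g n)))"
    by (simp add: case_prod_beta)
  also have "\<dots> \<le> (\<Sum>(g, h)\<in>E \<times> E. \<delta> * real (m n)) + (\<Sum>g\<in>D. \<delta> * real (m n))"
    using n1 n2 by (intro add_mono sum_mono) auto
  also have "\<dots> = real (card (E \<times> E) + card D) * \<delta> * real (m n)"
    by (simp add: algebra_simps case_prod_beta)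
  also have "\<dots> \<le> \<epsilon> * real (m n)"
    using \<epsilon> by (intro mult_right_mono) (auto simp: \<delta>_def field_simps)
  finally have cB: "real (card B) \<le> \<epsilon> * real (m n)" .
  have "perm_approx \<Gamma> E D \<epsilon> {1..m n} (f n)"
    unfolding perm_approx_def
    using mf(1)[of n] cB p ED
    by (intro conjI exI[of _ B]) (auto simp: B_def M_def L_def intro!: permutes_imp_bij)
  with mf(1) p show "\<exists>m > 0. \<exists>\<rho>. perm_approx \<Gamma> E D \<epsilon> {1..m::nat} \<rho> \<and> (\<forall>g\<in>carrier \<Gamma>. \<rho> g permutes {1..m})"
    by blast
qed

text \<open>Exhaust the countable group by finite sets \<open>E n\<close> and take an approximation
  for \<open>E n\<close> with tolerance \<open>1 / real (Suc n)\<close>.\<close>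

lemma locally_sofic_imp_sofic:
  assumes "locally_sofic \<Gamma>" "group \<Gamma>" "countable (carrier \<Gamma>)"
  shows "sofic \<Gamma>"
proof -
  interpret group \<Gamma> by fact
  \<comment> \<open>The sets increase and the enumeration reaches every element, so a given element
    lies in \<open>E n\<close> for all large \<open>n\<close>.\<close>
  define E where "E n = from_nat_into (carrier \<Gamma>) ` {..n::nat}" for n
  have EC: "E n \<subseteq> carrier \<Gamma>" for n
    using from_nat_into[of "carrier \<Gamma>"] one_closed by (auto simp: E_def)
  have ev: "\<forall>\<^sub>F n in sequentially. g \<in> E n" if g: "g \<in> carrier \<Gamma>" for g
  proof -
    obtain k where "from_nat_into (carrier \<Gamma>) k = g"
      using from_nat_into_surj[OF assms(3) g] by blast
    then show ?thesis
      by (auto simp: E_def eventually_sequentially intro!: exI[of _ k])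
  qed
  define Q where "Q n m \<rho> \<longleftrightarrow> m > 0 \<and>
    perm_approx \<Gamma> (E n) (E n - {\<one>\<^bsub>\<Gamma>\<^esub>}) (1 / real (Suc n)) {1..m::nat} \<rho> \<and> (\<forall>g\<in>carrier \<Gamma>. \<rho> g permutes {1..m})" for n m \<rho>
  have "\<exists>m \<rho>. Q n m \<rho>" for n
    using assms(1)[unfolded locally_sofic_def, rule_format, of "1 / real (Suc n)" "E n" "E n - {\<one>\<^bsub>\<Gamma>\<^esub>}"] EC[of n]
    by (auto simp: E_def Q_def)
  then obtain m f where Q: "\<And>n. Q n (m n) (f n)" by metis
  then have m: "\<And>n. m n > (0::nat)"
    and f: "\<And>n. perm_approx \<Gamma> (E n) (E n - {\<one>\<^bsub>\<Gamma>\<^esub>}) (1 / real (Suc n)) {1..m n} (f n)"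
    and p: "\<And>n g. g \<in> carrier \<Gamma> \<Longrightarrow> f n g permutes {1..m n}"
    by (simp_all add: Q_def)
  define R where "R n B \<longleftrightarrow> B \<subseteq> {1..m n} \<and> real (card B) \<le> 1 / real (Suc n) * real (m n) \<and>
     (\<forall>x\<in>{1..m n} - B. (\<forall>g\<in>E n. \<forall>h\<in>E n. f n (g \<otimes>\<^bsub>\<Gamma>\<^esub> h) x = f n g (f n h x)) \<and> (\<forall>g\<in>E n - {\<one>\<^bsub>\<Gamma>\<^esub>}. f n g x \<noteq> x))" for n B
  have "\<exists>B. R n B" for n
    using f[of n] unfolding perm_approx_def R_def by simp
  then obtain B where "\<And>n. R n (B n)" by metis
  then have B: "\<And>n. B n \<subseteq> {1..m n}" "\<And>n. real (card (B n)) \<le> 1 / real (Suc n) * real (m n)"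
    and B1: "\<And>n g h x. x \<in> {1..m n} - B n \<Longrightarrow> g \<in> E n \<Longrightarrow> h \<in> E n \<Longrightarrow> f n (g \<otimes>\<^bsub>\<Gamma>\<^esub> h) x = f n g (f n h x)"
    and B2: "\<And>n g x. x \<in> {1..m n} - B n \<Longrightarrow> g \<in> E n - {\<one>\<^bsub>\<Gamma>\<^esub>} \<Longrightarrow> f n g x \<noteq> x"
    unfolding R_def by blast+
  have finB: "finite (B n)" for n using B(1) finite_subset by blast
  have small: "(\<lambda>n. 1 / real (Suc n)) \<longlonglongrightarrow> 0"
    using LIMSEQ_inverse_real_of_nat by (simp add: inverse_eq_divide)
  have small1: "(\<lambda>n. 1 - 1 / real (Suc n)) \<longlonglongrightarrow> 1"
    using tendsto_diff[OF tendsto_const small, of 1] by simp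
  have "(\<lambda>n. hamming_dist (m n) (f n (g \<otimes>\<^bsub>\<Gamma>\<^esub> h)) (f n g \<otimes>\<^bsub>sym_group (m n)\<^esub> f n h)) \<longlonglongrightarrow> 0"
    if gh: "g \<in> carrier \<Gamma>" "h \<in> carrier \<Gamma>" for g h
  \<comment> \<open>Once \<open>g\<close> and \<open>h\<close> belong to \<open>E n\<close>, every
    point of disagreement lies in \<open>B n\<close>.\<close>
  proof (rule tendsto_sandwich[OF _ _ tendsto_const small])
    have *: "hamming_dist (m n) (f n (g \<otimes>\<^bsub>\<Gamma>\<^esub> h)) (f n g \<otimes>\<^bsub>sym_group (m n)\<^esub> f n h) =
      real (card {i\<in>{1..m n}. f n (g \<otimes>\<^bsub>\<Gamma>\<^esub> h) i \<noteq> f n g (f n h i)}) / real (m n)" for n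
      unfolding sym_group_mult using gh m
      by (subst hamming_dist_permutes) (auto simp: p permutes_compose simp del: One_nat_def)
    show "\<forall>\<^sub>F n in sequentially. 0 \<le> hamming_dist (m n) (f n (g \<otimes>\<^bsub>\<Gamma>\<^esub> h)) (f n g \<otimes>\<^bsub>sym_group (m n)\<^esub> f n h)"
      by (simp add: *)
    show "\<forall>\<^sub>F n in sequentially. hamming_dist (m n) (f n (g \<otimes>\<^bsub>\<Gamma>\<^esub> h)) (f n g \<otimes>\<^bsub>sym_group (m n)\<^esub> f n h) \<le> 1 / real (Suc n)"
      using ev[OF gh(1)] ev[OF gh(2)]
    proof eventually_elim
      case (elim n)
      have "card {i\<in>{1..m n}. f n (g \<otimes>\<^bsub>\<Gamma>\<^esub> h) i \<noteq> f n g (f n h i)} \<le> card (B n)"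
        using B1[of _ n g h] elim finB by (intro card_mono) auto
      then have "real (card {i\<in>{1..m n}. f n (g \<otimes>\<^bsub>\<Gamma>\<^esub> h) i \<noteq> f n g (f n h i)}) \<le> 1 / real (Suc n) * real (m n)"
        using B(2)[of n] by linarith
      then show ?case unfolding * using m[of n] by (simp add: field_simps)
    qed
  qed
  moreover have "(\<lambda>n. hamming_dist (m n) (f n g) \<one>\<^bsub>sym_group (m n)\<^esub>) \<longlonglongrightarrow> 1"
    if g: "g \<in> carrier \<Gamma> - {\<one>\<^bsub>\<Gamma>\<^esub>}" for g
  proof (rule tendsto_sandwich[OF _ _ small1 tendsto_const])
    have *: "hamming_dist (m n) (f n g) \<one>\<^bsub>sym_group (m n)\<^esub> =
      real (card {i\<in>{1..m n}. f n g i \<noteq> i}) / real (m n)" for n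
      unfolding sym_group_one using g m
      by (subst hamming_dist_permutes) (auto simp: p permutes_id simp del: One_nat_def)
    have le: "card {i\<in>{1..m n}. f n g i \<noteq> i} \<le> m n" for n
      by (rule order.trans[OF card_mono[of "{1..m n}"]]) auto
    show "\<forall>\<^sub>F n in sequentially. hamming_dist (m n) (f n g) \<one>\<^bsub>sym_group (m n)\<^esub> \<le> 1"
      using le m by (simp add: * field_simps)
    have g': "g \<in> carrier \<Gamma>" using g by simp
    show "\<forall>\<^sub>F n in sequentially. 1 - 1 / real (Suc n) \<le> hamming_dist (m n) (f n g) \<one>\<^bsub>sym_group (m n)\<^esub>"
      using ev[OF g']
    proof eventually_elim
      case (elim n)
      have "card ({1..m n} - B n) \<le> card {i\<in>{1..m n}. f n g i \<noteq> i}"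
        using B2[of _ n g] elim g by (intro card_mono) auto
      moreover have "card ({1..m n} - B n) = m n - card (B n)" "card (B n) \<le> m n"
        using B(1)[of n] finB card_mono[OF _ B(1)[of n]] by (auto simp: card_Diff_subset)
      ultimately have "real (m n) - 1 / real (Suc n) * real (m n) \<le> real (card {i\<in>{1..m n}. f n g i \<noteq> i})"
        using B(2)[of n] by linarith
      then show ?case unfolding * using m[of n] by (simp add: field_simps)
    qed
  qed
  ultimately show ?thesis
    unfolding sofic_def using assms m p
    by (intro conjI exI[of _ m] exI[of _ f]) (auto simp: sym_group_carrier simp del: One_nat_def)
qed

section \<open>Products, pullbacks and separation of finitely many elements\<close>

lemma perm_approx_prod:
  assumes \<sigma>: "perm_approx \<Gamma> E C \<epsilon> \<Omega> \<sigma>" and \<tau>: "perm_approx \<Gamma> E D \<delta> Y \<tau>"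
    and cl: "group \<Gamma>" "E \<subseteq> carrier \<Gamma>" "C \<subseteq> carrier \<Gamma>" "D \<subseteq> carrier \<Gamma>"
  shows "perm_approx \<Gamma> E (C \<union> D) (\<epsilon> + \<delta>) (\<Omega> \<times> Y) (\<lambda>g. map_prod (\<sigma> g) (\<tau> g))"
proof -
  interpret group \<Gamma> by fact
  have fin: "finite \<Omega>" "finite Y" "\<Omega> \<noteq> {}" "Y \<noteq> {}" using \<sigma> \<tau> by (auto simp: perm_approx_def)
  have bij: "\<And>g. g \<in> carrier \<Gamma> \<Longrightarrow> bij_betw (\<sigma> g) \<Omega> \<Omega>" "\<And>g. g \<in> carrier \<Gamma> \<Longrightarrow> bij_betw (\<tau> g) Y Y"
    using \<sigma> \<tau> by (auto simp: perm_approx_def)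
  obtain A where A: "A \<subseteq> \<Omega>" "real (card A) \<le> \<epsilon> * real (card \<Omega>)"
    "\<forall>x\<in>\<Omega> - A. (\<forall>g\<in>E. \<forall>h\<in>E. \<sigma> (g \<otimes>\<^bsub>\<Gamma>\<^esub> h) x = \<sigma> g (\<sigma> h x)) \<and> (\<forall>g\<in>C. \<sigma> g x \<noteq> x)"
    using \<sigma> unfolding perm_approx_def by blast
  obtain B where B: "B \<subseteq> Y" "real (card B) \<le> \<delta> * real (card Y)"
    "\<forall>x\<in>Y - B. (\<forall>g\<in>E. \<forall>h\<in>E. \<tau> (g \<otimes>\<^bsub>\<Gamma>\<^esub> h) x = \<tau> g (\<tau> h x)) \<and> (\<forall>g\<in>D. \<tau> g x \<noteq> x)"
    using \<tau> unfolding perm_approx_def by blast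
  \<comment> \<open>The exceptional set is a cross. Off it both coordinates are good, and a point of
    a product moves as soon as one of its coordinates does, which is why \<open>C\<close> and
    \<open>D\<close> are united.\<close>
  have "real (card (A \<times> Y \<union> \<Omega> \<times> B)) \<le> real (card A) * real (card Y) + real (card \<Omega>) * real (card B)"
    using card_Un_le[of "A \<times> Y" "\<Omega> \<times> B"] by (simp add: card_cartesian_product flip: of_nat_mult of_nat_add)
  also have "\<dots> \<le> (\<epsilon> * real (card \<Omega>)) * real (card Y) + real (card \<Omega>) * (\<delta> * real (card Y))"
    using A(2) B(2) by (intro add_mono mult_mono) auto
  finally have "real (card (A \<times> Y \<union> \<Omega> \<times> B)) \<le> (\<epsilon> + \<delta>) * real (card (\<Omega> \<times> Y))"
    by (simp add: card_cartesian_product algebra_simps)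
  moreover have "map_prod (\<sigma> (g \<otimes>\<^bsub>\<Gamma>\<^esub> h)) (\<tau> (g \<otimes>\<^bsub>\<Gamma>\<^esub> h)) z = map_prod (\<sigma> g) (\<tau> g) (map_prod (\<sigma> h) (\<tau> h) z)"
    if "z \<in> \<Omega> \<times> Y - (A \<times> Y \<union> \<Omega> \<times> B)" "g \<in> E" "h \<in> E" for z g h
  proof -
    have "fst z \<in> \<Omega> - A" "snd z \<in> Y - B" using that by auto
    then show ?thesis using A(3) B(3) that(2,3) by (cases z) auto
  qed
  moreover have "map_prod (\<sigma> g) (\<tau> g) z \<noteq> z"
    if "z \<in> \<Omega> \<times> Y - (A \<times> Y \<union> \<Omega> \<times> B)" "g \<in> C \<union> D" for z g
  proof -
    have "fst z \<in> \<Omega> - A" "snd z \<in> Y - B" using that by auto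
    then show ?thesis using A(3) B(3) that(2) by (cases z) auto
  qed
  moreover have "A \<times> Y \<union> \<Omega> \<times> B \<subseteq> \<Omega> \<times> Y" using A(1) B(1) by blast
  moreover have "\<forall>g\<in>carrier \<Gamma>. bij_betw (map_prod (\<sigma> g) (\<tau> g)) (\<Omega> \<times> Y) (\<Omega> \<times> Y)"
    using bij by (auto intro!: bij_betw_map_prod)
  ultimately show ?thesis
    unfolding perm_approx_def using fin
    by (intro conjI exI[of _ "A \<times> Y \<union> \<Omega> \<times> B"]) (simp, simp, assumption, assumption, assumption, simp)
qed

text \<open>Pulling back along a homomorphism keeps the exceptional set. This brings approximations
  of a wreath product back to \<open>Pol 2 G\<close>.\<close>

lemma perm_approx_hom:
  assumes "h \<in> hom \<Gamma> W" "perm_approx W (h ` E) (h ` D) \<epsilon> \<Omega> \<rho>" "E \<subseteq> carrier \<Gamma>"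
  shows "perm_approx \<Gamma> E D \<epsilon> \<Omega> (\<lambda>g. \<rho> (h g))"
  using assms unfolding perm_approx_def by (auto simp: hom_def Pi_iff subset_iff)

text \<open>Induction on \<open>D\<close>: each new element brings its own approximation, and the
  diagonal product with the previous one displaces everything treated so far. Both receive half of
  \<epsilon>.\<close>

lemma locally_sofic_if_residually:
  assumes "group \<Gamma>"
    and "\<And>E w \<epsilon>. finite E \<Longrightarrow> E \<subseteq> carrier \<Gamma> \<Longrightarrow> w \<in> carrier \<Gamma> \<Longrightarrow> w \<noteq> \<one>\<^bsub>\<Gamma>\<^esub> \<Longrightarrow> \<epsilon> > 0 \<Longrightarrow>
       \<exists>m > 0. \<exists>\<rho>. perm_approx \<Gamma> E {w} \<epsilon> {1..m::nat} \<rho>"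
  shows "locally_sofic \<Gamma>"
  unfolding locally_sofic_def
proof (intro allI impI)
  fix E D :: "'a set" and \<epsilon> :: real
  assume E: "finite E" "E \<subseteq> carrier \<Gamma>" and "finite D" "D \<subseteq> carrier \<Gamma> - {\<one>\<^bsub>\<Gamma>\<^esub>}" "\<epsilon> > 0"
  from this(3-) show "\<exists>m > 0. \<exists>\<rho>. perm_approx \<Gamma> E D \<epsilon> {1..m::nat} \<rho> \<and> (\<forall>g\<in>carrier \<Gamma>. \<rho> g permutes {1..m})"
  proof (induction D arbitrary: \<epsilon> rule: finite_induct)
    case empty
    \<comment> \<open>With nothing to displace, the trivial action on one point is exactly
      multiplicative.\<close>
    have "perm_approx \<Gamma> E {} \<epsilon> {()} (\<lambda>_. id)"
      using empty by (auto simp: perm_approx_def)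
    then show ?case using assms(1) E by (intro perm_approx_transport) auto
  next
    case (insert w D)
    obtain m \<rho> where 1: "m > (0::nat)" "perm_approx \<Gamma> E D (\<epsilon> / 2) {1..m} \<rho>"
      using insert.IH[of "\<epsilon> / 2"] insert.prems by auto
    obtain n \<tau> where 2: "n > (0::nat)" "perm_approx \<Gamma> E {w} (\<epsilon> / 2) {1..n} \<tau>"
      using assms(2)[of E w "\<epsilon> / 2"] E insert.prems by auto
    have "perm_approx \<Gamma> E ({w} \<union> D) (\<epsilon> / 2 + \<epsilon> / 2) ({1..n} \<times> {1..m}) (\<lambda>g. map_prod (\<tau> g) (\<rho> g))"
      using 1 2 insert.prems E assms(1) by (intro perm_approx_prod) auto
    then have "perm_approx \<Gamma> E (insert w D) \<epsilon> ({1..n} \<times> {1..m}) (\<lambda>g. map_prod (\<tau> g) (\<rho> g))" by simp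
    then show ?case using assms(1) E insert.prems by (intro perm_approx_transport) auto
  qed
qed


section \<open>Torsion abelian groups\<close>

text \<open>One element is adjoined at a time: its powers form a finite subgroup, and in an abelian
  group the product of two finite subgroups is again a finite subgroup.\<close>

lemma (in comm_group) torsion_finite_subset:
  assumes tors: "\<And>b. b \<in> carrier G \<Longrightarrow> \<exists>n>0. b [^] (n::nat) = \<one>"
    and F: "finite F" "F \<subseteq> carrier G"
  shows "\<exists>H. subgroup H G \<and> finite H \<and> F \<subseteq> H"
  using F
proof (induction F rule: finite_induct)
  case empty
  then show ?case by (intro exI[of _ "{\<one>}"]) (auto intro: triv_subgroup)
next
  case (insert b F)
  then obtain H where H: "subgroup H G" "finite H" "F \<subseteq> H" by auto
  have b: "b \<in> carrier G" using insert by simp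
  obtain n where n: "n > 0" "b [^] (n::nat) = \<one>" using tors[OF b] by blast
  have red: "b [^] (k::nat) = b [^] (k mod n)" for k
  proof -
    have "b [^] k = b [^] (n * (k div n) + k mod n)" by simp
    also have "\<dots> = (b [^] n) [^] (k div n) \<otimes> b [^] (k mod n)"
      using b by (simp only: nat_pow_mult nat_pow_pow nat_pow_closed)
    finally show ?thesis using n b by simp
  qed
  define P where "P = (\<lambda>k::nat. b [^] k) ` {..<n}"
  have Pin: "b [^] (k::nat) \<in> P" for k using red[of k] n by (auto simp: P_def)
  have "subgroup P G"
  proof (rule subgroupI)
    show "P \<subseteq> carrier G" "P \<noteq> {}" using b n by (auto simp: P_def)
    fix x assume "x \<in> P"
    then obtain k where k: "x = b [^] k" "k < n" by (auto simp: P_def)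
    \<comment> \<open>For \<open>k = 0\<close> the exponent is \<open>n\<close>, outside the range
      that defines \<open>P\<close>; \<open>Pin\<close> takes care of it by reduction modulo
      \<open>n\<close>.\<close>
    then have "inv x = b [^] (n - k)"
      using b n by (intro inv_equality) (auto simp: nat_pow_mult)
    then show "inv x \<in> P" using Pin by simp
  next
    fix x y assume "x \<in> P" "y \<in> P"
    then show "x \<otimes> y \<in> P" using b Pin by (auto simp: P_def nat_pow_mult)
  qed
  then have s: "subgroup (H <#> P) G" using H(1) by (intro mult_subgroups)
  moreover have "finite (H <#> P)" using H(2) by (auto simp: set_mult_def P_def)
  moreover have "insert b F \<subseteq> H <#> P"
  proof -
    have "b \<in> P" "\<one> \<in> P" using Pin[of 1] Pin[of 0] b by auto
    moreover have "\<one> \<in> H" using H(1) by (rule subgroup.one_closed)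
    moreover have "b = \<one> \<otimes> b" "\<And>x. x \<in> F \<Longrightarrow> x = x \<otimes> \<one>" using b insert by auto
    ultimately show ?thesis using H(3) by (fastforce simp: set_mult_def)
  qed
  ultimately show ?case by blast
qed

lemma (in comm_monoid) finprod_in_subgroup:
  assumes "subgroup H G" "\<And>i. i \<in> A \<Longrightarrow> f i \<in> H"
  shows "finprod G f A \<in> H"
  using assms(2)
proof (induction A rule: infinite_finite_induct)
  case (insert i A)
  moreover have "f \<in> A \<rightarrow> carrier G" "f i \<in> carrier G"
    using insert.prems subgroup.mem_carrier[OF assms(1)] by auto
  ultimately show ?case by (simp add: subgroup.m_closed[OF assms(1)])
qed (auto intro: subgroup.one_closed[OF assms(1)])


text \<open>Zorn's lemma gives \<open>M\<close> maximal among the subgroups that avoid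
  \<open>a\<close>. If no positive power of \<open>b\<close> were in \<open>M\<close>, adjoining any
  nonzero power of \<open>b\<close> would capture \<open>a\<close>; two such expressions of
  \<open>a\<close> then yield a nonzero power of \<open>b\<close> inside \<open>M\<close>.\<close>

lemma (in comm_group) torsion_mod_maximal_subgroup:
  assumes a: "a \<in> carrier G" "a \<noteq> \<one>"
  shows "\<exists>M. subgroup M G \<and> a \<notin> M \<and> (\<forall>b\<in>carrier G. \<exists>n>0. b [^] (n::nat) \<in> M)"
proof -
  define S where "S = {M. subgroup M G \<and> a \<notin> M}"
  have "\<exists>M\<in>S. \<forall>N\<in>S. M \<subseteq> N \<longrightarrow> N = M"
  proof (rule subset_Zorn_nonempty)
    show "S \<noteq> {}" using triv_subgroup a by (auto simp: S_def)
    fix \<C> assume ne: "\<C> \<noteq> {}" and ch: "subset.chain S \<C>"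
    have sub: "\<And>M. M \<in> \<C> \<Longrightarrow> subgroup M G \<and> a \<notin> M" using ch by (auto simp: subset.chain_def S_def)
    have "subgroup (\<Union>\<C>) G"
    proof (rule subgroupI)
      show "\<Union>\<C> \<subseteq> carrier G" using sub subgroup.subset by blast
      show "\<Union>\<C> \<noteq> {}" using ne sub subgroup.one_closed by blast
      show "\<And>x. x \<in> \<Union>\<C> \<Longrightarrow> inv x \<in> \<Union>\<C>" using sub subgroup.m_inv_closed by (metis Union_iff)
      fix x y assume "x \<in> \<Union>\<C>" "y \<in> \<Union>\<C>"
      then obtain M N where MN: "M \<in> \<C>" "N \<in> \<C>" "x \<in> M" "y \<in> N" by blast
      then have "M \<subseteq> N \<or> N \<subseteq> M" using ch by (auto simp: subset.chain_def)
      then show "x \<otimes> y \<in> \<Union>\<C>" using MN sub subgroup.m_closed by (metis UnionI subsetD)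
    qed
    then show "\<Union>\<C> \<in> S" using sub by (auto simp: S_def)
  qed
  then obtain M where M: "subgroup M G" "a \<notin> M"
    and max: "\<And>N. subgroup N G \<Longrightarrow> a \<notin> N \<Longrightarrow> M \<subseteq> N \<Longrightarrow> N = M" by (auto simp: S_def)
  have "\<exists>n>0. b [^] (n::nat) \<in> M" if b: "b \<in> carrier G" for b
  proof (rule ccontr)
    assume "\<not> ?thesis"
    then have nM: "\<And>n::nat. n > 0 \<Longrightarrow> b [^] n \<notin> M" by blast
    have nMi: "b [^] (i::int) \<notin> M" if "i \<noteq> 0" for i
    proof
      assume i: "b [^] i \<in> M"
      then have "inv (b [^] i) \<in> M" by (rule subgroup.m_inv_closed[OF M(1)])
      then have "b [^] (- i) \<in> M" using b by (simp add: int_pow_neg)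
      with i have "b [^] nat \<bar>i\<bar> \<in> M"
        by (cases "i \<ge> 0") (auto simp flip: int_pow_int)
      then show False using nM[of "nat \<bar>i\<bar>"] that by simp
    qed
    \<comment> \<open>\<open>P\<close> is the cyclic group generated by \<open>b [^] n\<close>. Its
      product with \<open>M\<close> is strictly larger than \<open>M\<close>, hence contains
      \<open>a\<close> by maximality.\<close>
    have gen: "\<exists>m\<in>M. \<exists>k::int. a = m \<otimes> b [^] (n * k)" if n: "n \<noteq> 0" for n :: int
    proof -
      define P where "P = range (\<lambda>k::int. b [^] (n * k))"
      have "subgroup P G"
      proof (rule subgroupI)
        show "P \<subseteq> carrier G" "P \<noteq> {}" using b by (auto simp: P_def)
        fix x y assume "x \<in> P" "y \<in> P"
        then obtain k l where kl: "x = b [^] (n * k)" "y = b [^] (n * l)" by (auto simp: P_def)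
        have "x \<otimes> y = b [^] (n * (k + l))" using b by (simp add: kl int_pow_mult distrib_left)
        then show "x \<otimes> y \<in> P" by (auto simp: P_def)
        have "inv x = b [^] (n * (- k))" using b by (simp add: kl int_pow_neg)
        then show "inv x \<in> P" unfolding P_def by (rule range_eqI)
      qed
      then have sub: "subgroup (M <#> P) G" using M(1) by (intro mult_subgroups)
      have "b [^] (n * 0) \<in> P" "b [^] (n * 1) \<in> P" unfolding P_def by blast+
      then have P1: "\<one> \<in> P" "b [^] n \<in> P" by auto
      have "m \<in> M <#> P" if "m \<in> M" for m
      proof -
        have "m = m \<otimes> \<one>" using subgroup.mem_carrier[OF M(1) that] by simp
        then show ?thesis using that P1 unfolding set_mult_def by blast
      qed
      moreover have "\<one> \<otimes> b [^] n \<in> M <#> P"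
        using subgroup.one_closed[OF M(1)] P1 unfolding set_mult_def by blast
      then have "b [^] n \<in> M <#> P" using b by simp
      ultimately have "a \<in> M <#> P" using max[OF sub] nMi[OF n] by blast
      then show ?thesis by (auto simp: set_mult_def P_def)
    qed
    obtain m j where 1: "m \<in> M" "a = m \<otimes> b [^] (1 * j :: int)" using gen[of 1] by auto
    have j: "j \<noteq> 0" using 1 M(2) subgroup.mem_carrier[OF M(1) 1(1)] by (intro notI) simp
    \<comment> \<open>Doubling \<open>j\<close> rules out a coincidence of exponents:
      \<open>j = 2 * j * k\<close> would force \<open>2 * k = 1\<close>.\<close>
    obtain m' k where 2: "m' \<in> M" "a = m' \<otimes> b [^] (2 * j * k :: int)" using gen[of "2 * j"] j by auto
    note cl = subgroup.mem_carrier[OF M(1) 1(1)] subgroup.mem_carrier[OF M(1) 2(1)]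
    have "b [^] (j - 2 * j * k) = inv m \<otimes> m'"
    proof -
      have "m \<otimes> b [^] j = m' \<otimes> b [^] (2 * j * k)" using 1 2 by simp
      then have "b [^] j = inv m \<otimes> (m' \<otimes> b [^] (2 * j * k))" using cl b by (simp add: inv_solve_left)
      also have "\<dots> = inv m \<otimes> m' \<otimes> b [^] (2 * j * k)" using cl b by (simp add: m_assoc)
      finally have "inv m \<otimes> m' = b [^] j \<otimes> inv (b [^] (2 * j * k))" using cl b by (simp add: inv_solve_right)
      then show ?thesis using b by (simp add: int_pow_diff)
    qed
    moreover have "inv m \<otimes> m' \<in> M" using 1 2 subgroup.m_closed[OF M(1)] subgroup.m_inv_closed[OF M(1)] by blast
    moreover have "j - 2 * j * k \<noteq> 0"
    proof
      assume "j - 2 * j * k = 0"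
      then have "j * (1 - 2 * k) = 0" by (simp add: algebra_simps)
      then show False using j by (simp, presburger)
    qed
    ultimately show False using nMi by metis
  qed
  with M show ?thesis by blast
qed

text \<open>Abelianize first, then divide by a subgroup that avoids the class of \<open>a\<close>;
  two successive quotients account for the type of cosets of cosets.\<close>

lemma torsion_abelian_quotient:
  fixes G :: "('a, 'b) monoid_scheme"
  assumes "group G" "a \<in> carrier G"
  shows "\<exists>(B :: 'a set set monoid) \<pi>. comm_group B \<and> (\<forall>b\<in>carrier B. \<exists>n>0. b [^]\<^bsub>B\<^esub> (n::nat) = \<one>\<^bsub>B\<^esub>) \<and>
    \<pi> \<in> hom G B \<and> (a \<notin> derived G (carrier G) \<longrightarrow> \<pi> a \<noteq> \<one>\<^bsub>B\<^esub>)"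
proof -
  interpret G: group G by fact
  let ?N = "derived G (carrier G)"
  define A where "A = G Mod ?N"
  interpret A: comm_group A unfolding A_def by (rule G.derived_quot_is_comm_group)
  have N: "?N \<lhd> G" using G.derived_is_normal[OF G.normal_self] .
  define \<nu> where "\<nu> = (\<lambda>g. ?N #>\<^bsub>G\<^esub> g)"
  have \<nu>: "\<nu> \<in> hom G A" unfolding \<nu>_def A_def by (rule normal.r_coset_hom_Mod[OF N])
  have \<nu>a: "\<nu> a \<in> carrier A" using \<nu> assms by (auto simp: hom_def)
  have \<nu>1: "\<nu> a \<noteq> \<one>\<^bsub>A\<^esub>" if "a \<notin> ?N"
    using that assms G.rcos_self[OF assms(2) normal_imp_subgroup[OF N]] by (auto simp: \<nu>_def A_def)
  have "\<exists>M. subgroup M A \<and> (a \<notin> ?N \<longrightarrow> \<nu> a \<notin> M) \<and> (\<forall>b\<in>carrier A. \<exists>n>0. b [^]\<^bsub>A\<^esub> (n::nat) \<in> M)"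
  proof (cases "a \<in> ?N")
    case True
    \<comment> \<open>Here nothing has to survive, and the trivial quotient will do.\<close>
    then show ?thesis by (intro exI[of _ "carrier A"]) (auto intro: A.subgroup_self exI[of _ 1])
  next
    case False
    then show ?thesis using A.torsion_mod_maximal_subgroup[OF \<nu>a \<nu>1] by blast
  qed
  then obtain M where M: "subgroup M A" "a \<notin> ?N \<Longrightarrow> \<nu> a \<notin> M"
    "\<And>b. b \<in> carrier A \<Longrightarrow> \<exists>n>0. b [^]\<^bsub>A\<^esub> (n::nat) \<in> M" by blast
  define B where "B = A Mod M"
  interpret M: normal M A using M(1) by (rule A.subgroup_imp_normal)
  define \<mu> where "\<mu> = (\<lambda>g. M #>\<^bsub>A\<^esub> g)"
  have \<mu>: "\<mu> \<in> hom A B" unfolding \<mu>_def B_def by (rule M.r_coset_hom_Mod)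
  have "comm_group B" unfolding B_def by (rule A.abelian_FactGroup[OF M(1)])
  moreover have "\<exists>n>0. b [^]\<^bsub>B\<^esub> (n::nat) = \<one>\<^bsub>B\<^esub>" if "b \<in> carrier B" for b
  proof -
    obtain x where x: "x \<in> carrier A" "b = M #>\<^bsub>A\<^esub> x"
      using \<open>b \<in> carrier B\<close> by (auto simp: B_def carrier_FactGroup)
    obtain n where n: "n > 0" "x [^]\<^bsub>A\<^esub> (n::nat) \<in> M" using M(3)[OF x(1)] by blast
    have "b [^]\<^bsub>B\<^esub> n = M #>\<^bsub>A\<^esub> (x [^]\<^bsub>A\<^esub> n)" using x by (simp add: B_def M.FactGroup_pow)
    also have "\<dots> = M" using n(2) by (rule M.rcos_const[OF A.group_axioms])
    finally show ?thesis using n by (auto simp: B_def)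
  qed
  moreover have "\<mu> \<circ> \<nu> \<in> hom G B" using \<nu> \<mu> by (rule hom_compose)
  moreover have "(\<mu> \<circ> \<nu>) a \<noteq> \<one>\<^bsub>B\<^esub>" if "a \<notin> ?N"
    using A.rcos_self[OF \<nu>a M(1)] M(2)[OF that] by (auto simp: \<mu>_def B_def)
  ultimately show ?thesis by blast
qed


section \<open>Wreath products with abelian lamps\<close>

text \<open>The restricted wreath product as a semidirect product of pairs. Lamp configurations are
  total functions forced to be \<one> off \<open>carrier G\<close>, so that configurations with the
  same lamps on \<open>carrier G\<close> are equal.\<close>

definition wreath :: "('b, 'c) monoid_scheme \<Rightarrow> ('a, 'd) monoid_scheme \<Rightarrow> (('a \<Rightarrow> 'b) \<times> 'a) monoid" where
  "wreath B G = \<lparr>carrier = {(u, g). g \<in> carrier G \<and> range u \<subseteq> carrier B \<and>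
       finite {k. u k \<noteq> \<one>\<^bsub>B\<^esub>} \<and> {k. u k \<noteq> \<one>\<^bsub>B\<^esub>} \<subseteq> carrier G},
     monoid.mult = (\<lambda>(u, g) (v, h).
       (\<lambda>k. if k \<in> carrier G then u k \<otimes>\<^bsub>B\<^esub> v (inv\<^bsub>G\<^esub> g \<otimes>\<^bsub>G\<^esub> k) else \<one>\<^bsub>B\<^esub>, g \<otimes>\<^bsub>G\<^esub> h)),
     one = (\<lambda>_. \<one>\<^bsub>B\<^esub>, \<one>\<^bsub>G\<^esub>)\<rparr>"

locale wreath_product = L: comm_group B + G: group G
  for B :: "('b, 'c) monoid_scheme" (structure) and G :: "('a, 'd) monoid_scheme" (structure)
begin

abbreviation supp :: "('a \<Rightarrow> 'b) \<Rightarrow> 'a set" where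
  "supp u \<equiv> {k. u k \<noteq> \<one>\<^bsub>B\<^esub>}"

lemma wreath_carrierI:
  assumes "g \<in> carrier G" "\<And>k. u k \<in> carrier B" "finite S" "S \<subseteq> carrier G" "\<And>k. k \<notin> S \<Longrightarrow> u k = \<one>\<^bsub>B\<^esub>"
  shows "(u, g) \<in> carrier (wreath B G)"
proof -
  have "supp u \<subseteq> S" using assms by auto
  with assms show ?thesis by (auto simp: wreath_def intro: finite_subset)
qed

lemma wreath_carrierD:
  assumes "(u, g) \<in> carrier (wreath B G)"
  shows "g \<in> carrier G" "u k \<in> carrier B" "finite (supp u)" "supp u \<subseteq> carrier G"
    "k \<notin> carrier G \<Longrightarrow> u k = \<one>\<^bsub>B\<^esub>"
  using assms by (auto simp: wreath_def)

lemma mult_wreath: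
  "(u, g) \<otimes>\<^bsub>wreath B G\<^esub> (v, h) =
    (\<lambda>k. if k \<in> carrier G then u k \<otimes>\<^bsub>B\<^esub> v (inv\<^bsub>G\<^esub> g \<otimes>\<^bsub>G\<^esub> k) else \<one>\<^bsub>B\<^esub>, g \<otimes>\<^bsub>G\<^esub> h)"
  by (simp add: wreath_def)

lemma one_wreath: "\<one>\<^bsub>wreath B G\<^esub> = (\<lambda>_. \<one>\<^bsub>B\<^esub>, \<one>\<^bsub>G\<^esub>)"
  by (simp add: wreath_def)

lemma supp_mult:
  assumes "(u, g) \<in> carrier (wreath B G)" "(v, h) \<in> carrier (wreath B G)"
    and "u k \<otimes>\<^bsub>B\<^esub> v (inv\<^bsub>G\<^esub> g \<otimes>\<^bsub>G\<^esub> k) \<noteq> \<one>\<^bsub>B\<^esub>" "k \<in> carrier G"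
  shows "k \<in> supp u \<union> (\<lambda>l. g \<otimes>\<^bsub>G\<^esub> l) ` supp v"
proof (cases "u k = \<one>\<^bsub>B\<^esub>")
  case True
  then have "v (inv\<^bsub>G\<^esub> g \<otimes>\<^bsub>G\<^esub> k) \<noteq> \<one>\<^bsub>B\<^esub>" using assms(3) by auto
  moreover have "k = g \<otimes>\<^bsub>G\<^esub> (inv\<^bsub>G\<^esub> g \<otimes>\<^bsub>G\<^esub> k)"
    using assms(4) wreath_carrierD(1)[OF assms(1)] by (simp add: G.m_assoc[symmetric])
  ultimately show ?thesis by blast
qed auto

lemma group_wreath: "group (wreath B G)"
proof (rule groupI)
  fix p q assume pq: "p \<in> carrier (wreath B G)" "q \<in> carrier (wreath B G)"
  obtain u g v h where [simp]: "p = (u, g)" "q = (v, h)" by (cases p, cases q)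
  note p = wreath_carrierD[OF pq(1)[simplified]] and q = wreath_carrierD[OF pq(2)[simplified]]
  show "p \<otimes>\<^bsub>wreath B G\<^esub> q \<in> carrier (wreath B G)"
    unfolding \<open>p = _\<close> \<open>q = _\<close> mult_wreath
  proof (rule wreath_carrierI)
    show "finite (supp u \<union> (\<lambda>l. g \<otimes>\<^bsub>G\<^esub> l) ` supp v)" using p q by auto
    show "supp u \<union> (\<lambda>l. g \<otimes>\<^bsub>G\<^esub> l) ` supp v \<subseteq> carrier G" using p q by auto
    show "k \<notin> supp u \<union> (\<lambda>l. g \<otimes>\<^bsub>G\<^esub> l) ` supp v \<Longrightarrow>
       (if k \<in> carrier G then u k \<otimes>\<^bsub>B\<^esub> v (inv\<^bsub>G\<^esub> g \<otimes>\<^bsub>G\<^esub> k) else \<one>\<^bsub>B\<^esub>) = \<one>\<^bsub>B\<^esub>" for k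
      using supp_mult[of u g v h k] pq by auto
  qed (use p q in auto)
next
  show "\<one>\<^bsub>wreath B G\<^esub> \<in> carrier (wreath B G)"
    unfolding one_wreath by (rule wreath_carrierI[where S = "{}"]) auto
next
  fix p q r assume *: "p \<in> carrier (wreath B G)" "q \<in> carrier (wreath B G)" "r \<in> carrier (wreath B G)"
  obtain u g v h w k where [simp]: "p = (u, g)" "q = (v, h)" "r = (w, k)" by (cases p, cases q, cases r)
  note D = wreath_carrierD[OF *(1)[simplified]] wreath_carrierD[OF *(2)[simplified]] wreath_carrierD[OF *(3)[simplified]]
  show "p \<otimes>\<^bsub>wreath B G\<^esub> q \<otimes>\<^bsub>wreath B G\<^esub> r = p \<otimes>\<^bsub>wreath B G\<^esub> (q \<otimes>\<^bsub>wreath B G\<^esub> r)"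
    using D by (auto simp: mult_wreath L.m_assoc G.m_assoc G.inv_mult_group)
next
  fix p assume *: "p \<in> carrier (wreath B G)"
  obtain u g where [simp]: "p = (u, g)" by (cases p)
  note D = wreath_carrierD[OF *[simplified]]
  show "\<one>\<^bsub>wreath B G\<^esub> \<otimes>\<^bsub>wreath B G\<^esub> p = p"
    using D by (auto simp: mult_wreath one_wreath)
  \<comment> \<open>The configuration solves the equation for a left inverse: the lamp of
    \<open>?q\<close> at \<open>k\<close> has to cancel \<open>u (g \<otimes> k)\<close>.\<close>
  let ?q = "(\<lambda>k. if k \<in> carrier G then inv\<^bsub>B\<^esub> u (g \<otimes>\<^bsub>G\<^esub> k) else \<one>\<^bsub>B\<^esub>, inv\<^bsub>G\<^esub> g)"
  have "?q \<in> carrier (wreath B G)"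
  proof (rule wreath_carrierI)
    show "finite ((\<lambda>l. inv\<^bsub>G\<^esub> g \<otimes>\<^bsub>G\<^esub> l) ` supp u)" using D by auto
    show "(\<lambda>l. inv\<^bsub>G\<^esub> g \<otimes>\<^bsub>G\<^esub> l) ` supp u \<subseteq> carrier G" using D by auto
    fix k assume k: "k \<notin> (\<lambda>l. inv\<^bsub>G\<^esub> g \<otimes>\<^bsub>G\<^esub> l) ` supp u"
    have "u (g \<otimes>\<^bsub>G\<^esub> k) = \<one>\<^bsub>B\<^esub>" if "k \<in> carrier G"
    proof (rule ccontr)
      assume "u (g \<otimes>\<^bsub>G\<^esub> k) \<noteq> \<one>\<^bsub>B\<^esub>"
      moreover have "k = inv\<^bsub>G\<^esub> g \<otimes>\<^bsub>G\<^esub> (g \<otimes>\<^bsub>G\<^esub> k)" using that D by (simp add: G.m_assoc[symmetric])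
      ultimately show False using k by blast
    qed
    then show "(if k \<in> carrier G then inv\<^bsub>B\<^esub> u (g \<otimes>\<^bsub>G\<^esub> k) else \<one>\<^bsub>B\<^esub>) = \<one>\<^bsub>B\<^esub>" by auto
  qed (use D in auto)
  moreover have "?q \<otimes>\<^bsub>wreath B G\<^esub> p = \<one>\<^bsub>wreath B G\<^esub>"
    using D by (auto simp: mult_wreath one_wreath)
  ultimately show "\<exists>q\<in>carrier (wreath B G). q \<otimes>\<^bsub>wreath B G\<^esub> p = \<one>\<^bsub>wreath B G\<^esub>" by blast
qed

text \<open>The amount that \<open>(u, g)\<close>, acting at the point \<open>x\<close>, deposits at
  the site \<open>y\<close>: the lamp at \<open>k\<close> is carried to
  \<open>\<sigma> (inv k \<otimes> g) x\<close>. As \<sigma> is merely an approximate action,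
  several lamps may land on one site, hence the product.\<close>

definition lamp :: "('a \<Rightarrow> 'x \<Rightarrow> 'x) \<Rightarrow> ('a \<Rightarrow> 'b) \<Rightarrow> 'a \<Rightarrow> 'x \<Rightarrow> 'x \<Rightarrow> 'b" where
  "lamp \<sigma> u g x y = finprod B (\<lambda>k. if \<sigma> (inv\<^bsub>G\<^esub> k \<otimes>\<^bsub>G\<^esub> g) x = y then u k else \<one>\<^bsub>B\<^esub>) (supp u)"

lemma lamp_superset:
  assumes "(u, g) \<in> carrier (wreath B G)" "finite K" "supp u \<subseteq> K"
  shows "lamp \<sigma> u g x y = finprod B (\<lambda>k. if \<sigma> (inv\<^bsub>G\<^esub> k \<otimes>\<^bsub>G\<^esub> g) x = y then u k else \<one>\<^bsub>B\<^esub>) K"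
  unfolding lamp_def using assms wreath_carrierD[OF assms(1)]
  by (intro L.finprod_mono_neutral_cong_left) auto

lemma lamp_closed: "(u, g) \<in> carrier (wreath B G) \<Longrightarrow> lamp \<sigma> u g x y \<in> carrier B"
  unfolding lamp_def using wreath_carrierD[of u g] by (intro L.finprod_closed) auto

text \<open>Each lamp of the product is \<open>u k\<close> times a shifted lamp of \<open>v\<close>,
  so the deposit splits into two factors. The first becomes the deposit of \<open>(u, g)\<close> at
  \<open>\<sigma> h x\<close> by the assumption \<open>good\<close>; the second becomes that of
  \<open>(v, h)\<close> at \<open>x\<close> after the substitution
  \<open>k = g \<otimes> l\<close>.\<close>

lemma lamp_mult:
  assumes p: "(u, g) \<in> carrier (wreath B G)" and q: "(v, h) \<in> carrier (wreath B G)"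
    and pq: "(u, g) \<otimes>\<^bsub>wreath B G\<^esub> (v, h) = (w, j)"
    and good: "\<And>k. k \<in> supp u \<Longrightarrow> \<sigma> (inv\<^bsub>G\<^esub> k \<otimes>\<^bsub>G\<^esub> g \<otimes>\<^bsub>G\<^esub> h) x = \<sigma> (inv\<^bsub>G\<^esub> k \<otimes>\<^bsub>G\<^esub> g) (\<sigma> h x)"
  shows "lamp \<sigma> w j x y = lamp \<sigma> v h x y \<otimes>\<^bsub>B\<^esub> lamp \<sigma> u g (\<sigma> h x) y"
proof -
  note P = wreath_carrierD[OF p] and Q = wreath_carrierD[OF q]
  have w: "w k = (if k \<in> carrier G then u k \<otimes>\<^bsub>B\<^esub> v (inv\<^bsub>G\<^esub> g \<otimes>\<^bsub>G\<^esub> k) else \<one>\<^bsub>B\<^esub>)"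
    and j: "j = g \<otimes>\<^bsub>G\<^esub> h" for k using pq by (auto simp: mult_wreath)
  \<comment> \<open>A common index set for all the products: it contains the supports of
    \<open>u\<close>, of the shifted \<open>v\<close> and hence of \<open>w\<close>.\<close>
  define K where "K = supp u \<union> (\<lambda>l. g \<otimes>\<^bsub>G\<^esub> l) ` supp v"
  have K: "finite K" "K \<subseteq> carrier G" "supp u \<subseteq> K" using P Q by (auto simp: K_def)
  have wK: "supp w \<subseteq> K"
    using supp_mult[OF p q] by (auto simp: w K_def split: if_splits)
  have wj: "(w, j) \<in> carrier (wreath B G)" using group.is_monoid[OF group_wreath] p q pq
    by (metis monoid.m_closed)
  let ?c = "\<lambda>k. \<sigma> (inv\<^bsub>G\<^esub> k \<otimes>\<^bsub>G\<^esub> j) x = y"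
  have "lamp \<sigma> w j x y = finprod B (\<lambda>k. if ?c k then w k else \<one>\<^bsub>B\<^esub>) K"
    using lamp_superset[OF wj K(1) wK] .
  also have "\<dots> = finprod B (\<lambda>k. (if ?c k then u k else \<one>\<^bsub>B\<^esub>) \<otimes>\<^bsub>B\<^esub>
      (if ?c k then v (inv\<^bsub>G\<^esub> g \<otimes>\<^bsub>G\<^esub> k) else \<one>\<^bsub>B\<^esub>)) K"
    using K P Q by (intro L.finprod_cong') (auto simp: w)
  also have "\<dots> = finprod B (\<lambda>k. if ?c k then u k else \<one>\<^bsub>B\<^esub>) K \<otimes>\<^bsub>B\<^esub>
      finprod B (\<lambda>k. if ?c k then v (inv\<^bsub>G\<^esub> g \<otimes>\<^bsub>G\<^esub> k) else \<one>\<^bsub>B\<^esub>) K"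
    using P Q by (intro L.finprod_multf) auto
  also have "finprod B (\<lambda>k. if ?c k then u k else \<one>\<^bsub>B\<^esub>) K = lamp \<sigma> u g (\<sigma> h x) y"
    unfolding lamp_superset[OF p K(1,3)]
  proof (rule L.finprod_cong')
    fix k assume k: "k \<in> K"
    have "inv\<^bsub>G\<^esub> k \<otimes>\<^bsub>G\<^esub> j = inv\<^bsub>G\<^esub> k \<otimes>\<^bsub>G\<^esub> g \<otimes>\<^bsub>G\<^esub> h"
      using k K P Q by (auto simp: j G.m_assoc)
    then show "(if ?c k then u k else \<one>\<^bsub>B\<^esub>) =
      (if \<sigma> (inv\<^bsub>G\<^esub> k \<otimes>\<^bsub>G\<^esub> g) (\<sigma> h x) = y then u k else \<one>\<^bsub>B\<^esub>)"
      using good[of k] by (cases "u k = \<one>\<^bsub>B\<^esub>") auto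
  qed (use P in auto)
  also have "finprod B (\<lambda>k. if ?c k then v (inv\<^bsub>G\<^esub> g \<otimes>\<^bsub>G\<^esub> k) else \<one>\<^bsub>B\<^esub>) K =
      finprod B (\<lambda>k. if ?c k then v (inv\<^bsub>G\<^esub> g \<otimes>\<^bsub>G\<^esub> k) else \<one>\<^bsub>B\<^esub>) ((\<lambda>l. g \<otimes>\<^bsub>G\<^esub> l) ` supp v)"
  proof (rule L.finprod_mono_neutral_cong_right)
    fix k assume k: "k \<in> K - (\<lambda>l. g \<otimes>\<^bsub>G\<^esub> l) ` supp v"
    then have "k = g \<otimes>\<^bsub>G\<^esub> (inv\<^bsub>G\<^esub> g \<otimes>\<^bsub>G\<^esub> k)" using K P by (auto simp: G.m_assoc[symmetric])
    then have "v (inv\<^bsub>G\<^esub> g \<otimes>\<^bsub>G\<^esub> k) = \<one>\<^bsub>B\<^esub>" using k by blast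
    then show "(if ?c k then v (inv\<^bsub>G\<^esub> g \<otimes>\<^bsub>G\<^esub> k) else \<one>\<^bsub>B\<^esub>) = \<one>\<^bsub>B\<^esub>" by simp
  qed (use K Q in \<open>auto simp: K_def\<close>)
  also have "\<dots> = finprod B (\<lambda>l. if ?c (g \<otimes>\<^bsub>G\<^esub> l) then v (inv\<^bsub>G\<^esub> g \<otimes>\<^bsub>G\<^esub> (g \<otimes>\<^bsub>G\<^esub> l)) else \<one>\<^bsub>B\<^esub>) (supp v)"
  proof (rule L.finprod_reindex)
    show "inj_on (\<lambda>l. g \<otimes>\<^bsub>G\<^esub> l) (supp v)"
      using P(1) Q(4) by (meson G.inj_on_cmult inj_on_subset)
  qed (use Q in auto)
  also have "\<dots> = lamp \<sigma> v h x y"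
    unfolding lamp_def
  proof (rule L.finprod_cong')
    fix l assume "l \<in> supp v"
    then have l: "l \<in> carrier G" using Q by auto
    then have "inv\<^bsub>G\<^esub> g \<otimes>\<^bsub>G\<^esub> (g \<otimes>\<^bsub>G\<^esub> l) = l" using P by (simp add: G.m_assoc[symmetric])
    moreover have "inv\<^bsub>G\<^esub> (g \<otimes>\<^bsub>G\<^esub> l) \<otimes>\<^bsub>G\<^esub> j = inv\<^bsub>G\<^esub> l \<otimes>\<^bsub>G\<^esub> (inv\<^bsub>G\<^esub> g \<otimes>\<^bsub>G\<^esub> g) \<otimes>\<^bsub>G\<^esub> h"
      using l P Q by (simp only: j G.m_assoc G.inv_mult_group G.inv_closed G.m_closed)
    then have "inv\<^bsub>G\<^esub> (g \<otimes>\<^bsub>G\<^esub> l) \<otimes>\<^bsub>G\<^esub> j = inv\<^bsub>G\<^esub> l \<otimes>\<^bsub>G\<^esub> h"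
      using l P by simp
    ultimately show "(if ?c (g \<otimes>\<^bsub>G\<^esub> l) then v (inv\<^bsub>G\<^esub> g \<otimes>\<^bsub>G\<^esub> (g \<otimes>\<^bsub>G\<^esub> l)) else \<one>\<^bsub>B\<^esub>) =
      (if \<sigma> (inv\<^bsub>G\<^esub> l \<otimes>\<^bsub>G\<^esub> h) x = y then v l else \<one>\<^bsub>B\<^esub>)" by simp
  qed (use Q in auto)
  also have "lamp \<sigma> u g (\<sigma> h x) y \<otimes>\<^bsub>B\<^esub> lamp \<sigma> v h x y = lamp \<sigma> v h x y \<otimes>\<^bsub>B\<^esub> lamp \<sigma> u g (\<sigma> h x) y"
    by (intro L.m_comm lamp_closed p q)
  finally show ?thesis .
qed

end

text \<open>A finite group \<open>H\<close> of lamp values and an approximation of \<open>G\<close>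
  on \<open>\<Omega>\<close> give a model on pairs of an \<open>H\<close>-valued configuration and a
  current position. Acting adds deposits to the configuration and moves the position; whether a pair
  is good depends on its position alone.\<close>

lemma locally_sofic_wreath:
  fixes B :: "('b, 'c) monoid_scheme" and G :: "('a, 'd) monoid_scheme"
  assumes "comm_group B" "group G" "locally_sofic G"
    and tors: "\<And>b. b \<in> carrier B \<Longrightarrow> \<exists>n>0. b [^]\<^bsub>B\<^esub> (n::nat) = \<one>\<^bsub>B\<^esub>"
  shows "locally_sofic (wreath B G)"
  unfolding locally_sofic_def
proof (intro allI impI)
  interpret L: comm_group B by fact
  interpret G: group G by fact
  interpret wreath_product B G by unfold_locales
  interpret W: group "wreath B G" by (rule group_wreath)
  let ?W = "wreath B G"
  fix E D :: "(('a \<Rightarrow> 'b) \<times> 'a) set" and \<epsilon> :: real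
  assume \<epsilon>: "\<epsilon> > 0" and fin: "finite E" "finite D"
    and ED: "E \<subseteq> carrier ?W" "D \<subseteq> carrier ?W - {\<one>\<^bsub>?W\<^esub>}"
  define P where "P = E \<union> D"
  have P: "finite P" "P \<subseteq> carrier ?W" using fin ED by (auto simp: P_def)
  note PD = wreath_carrierD[OF subsetD[OF P(2)]]
  define F where "F = (\<Union>p\<in>P. fst p ` supp (fst p))"
  have F: "finite F" "F \<subseteq> carrier B" using P(1) PD by (auto simp: F_def)
  obtain H where H: "subgroup H B" "finite H" "F \<subseteq> H"
    using L.torsion_finite_subset[OF tors F] by auto
  have uH: "range u \<subseteq> H" if "(u, g) \<in> P" for u g
  proof -
    have "u k \<in> H" for k
      using that H(3) subgroup.one_closed[OF H(1)]
      by (cases "u k = \<one>\<^bsub>B\<^esub>") (force simp: F_def)+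
    then show ?thesis by auto
  qed
  \<comment> \<open>Where \<sigma> has to be multiplicative: at \<open>g\<close> for the position,
    at \<open>inv k \<otimes> g\<close> for \<open>lamp_mult\<close>, at \<open>k\<close> and
    \<open>inv k\<close> to compare deposit sites, and at \<one> to see that
    \<open>\<sigma> \<one>\<close> fixes good points.\<close>
  define T where "T = (\<Union>(u, g)\<in>P. insert g (supp u \<union> (\<lambda>k. inv\<^bsub>G\<^esub> k) ` supp u \<union> (\<lambda>k. inv\<^bsub>G\<^esub> k \<otimes>\<^bsub>G\<^esub> g) ` supp u)) \<union> {\<one>\<^bsub>G\<^esub>}"
  have PG: "u k \<noteq> \<one>\<^bsub>B\<^esub> \<Longrightarrow> k \<in> carrier G" if "(u, g) \<in> P" for u g k
    using PD(4)[OF that] by auto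
  have T: "finite T" "T \<subseteq> carrier G" using P(1) PD(1,3) PG by (auto simp: T_def)
  have TI: "g \<in> T" "k \<in> supp u \<Longrightarrow> k \<in> T" "k \<in> supp u \<Longrightarrow> inv\<^bsub>G\<^esub> k \<in> T"
    "k \<in> supp u \<Longrightarrow> inv\<^bsub>G\<^esub> k \<otimes>\<^bsub>G\<^esub> g \<in> T" "\<one>\<^bsub>G\<^esub> \<in> T" if "(u, g) \<in> P" for u g k
    using that by (force simp: T_def)+
  \<comment> \<open>Freeness on \<open>T\<close> moves the position when \<open>g\<close> is
    nontrivial; freeness on the quotients makes distinct lamps land on distinct sites.\<close>
  define T' where "T' = (T \<union> (\<lambda>(a, b). a \<otimes>\<^bsub>G\<^esub> inv\<^bsub>G\<^esub> b) ` (T \<times> T)) - {\<one>\<^bsub>G\<^esub>}"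
  have T': "finite T'" "T' \<subseteq> carrier G - {\<one>\<^bsub>G\<^esub>}" using T by (auto simp: T'_def)
  obtain m \<sigma> where m: "m > (0::nat)" and ap: "perm_approx G T T' \<epsilon> {1..m} \<sigma>"
    using assms(3)[unfolded locally_sofic_def, rule_format, of \<epsilon> T T'] \<epsilon> T T' by auto
  define \<Omega> where "\<Omega> = {1..m}"
  have \<Omega>: "finite \<Omega>" "\<Omega> \<noteq> {}" using m by (auto simp: \<Omega>_def)
  have bij: "\<And>g. g \<in> carrier G \<Longrightarrow> bij_betw (\<sigma> g) \<Omega> \<Omega>"
    using ap by (simp add: perm_approx_def \<Omega>_def)
  obtain A where A: "A \<subseteq> \<Omega>" "real (card A) \<le> \<epsilon> * real (card \<Omega>)"
    and mult: "\<And>x g h. x \<in> \<Omega> - A \<Longrightarrow> g \<in> T \<Longrightarrow> h \<in> T \<Longrightarrow> \<sigma> (g \<otimes>\<^bsub>G\<^esub> h) x = \<sigma> g (\<sigma> h x)"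
    and free: "\<And>x g. x \<in> \<Omega> - A \<Longrightarrow> g \<in> T' \<Longrightarrow> \<sigma> g x \<noteq> x"
    using ap unfolding perm_approx_def \<Omega>_def by metis
  have \<sigma>\<Omega>: "\<And>g x. g \<in> carrier G \<Longrightarrow> x \<in> \<Omega> \<Longrightarrow> \<sigma> g x \<in> \<Omega>" using bij by (auto simp: bij_betw_def)
  define \<Psi> where "\<Psi> = (\<Omega> \<rightarrow>\<^sub>E H) \<times> \<Omega>"
  \<comment> \<open>Elements with lamps outside \<open>H\<close> act as the identity, a default that
    keeps every \<open>\<rho> p\<close> a bijection of \<open>\<Psi>\<close>. By \<open>uH\<close>
    and \<open>wH\<close> the elements of \<open>E\<close> and \<open>D\<close> and the products of
    elements of \<open>E\<close> fall under the first branch.\<close>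
  define \<rho> where "\<rho> p z = (if range (fst p) \<subseteq> H
     then (\<lambda>y\<in>\<Omega>. fst z y \<otimes>\<^bsub>B\<^esub> lamp \<sigma> (fst p) (snd p) (snd z) y, \<sigma> (snd p) (snd z)) else z)" for p z
  have HB: "H \<subseteq> carrier B" using H(1) by (rule subgroup.subset)
  have fin\<Psi>: "finite \<Psi>" using \<Omega> H by (auto simp: \<Psi>_def intro!: finite_PiE)
  have "\<Psi> \<noteq> {}" using \<Omega> subgroup.one_closed[OF H(1)] by (auto simp: \<Psi>_def PiE_eq_empty_iff)
  have lampH: "lamp \<sigma> u g x y \<in> H" if "range u \<subseteq> H" for u g x y
    unfolding lamp_def using that subgroup.one_closed[OF H(1)]
    by (intro L.finprod_in_subgroup H(1)) auto
  have bij\<rho>: "bij_betw (\<rho> p) \<Psi> \<Psi>" if p: "p \<in> carrier ?W" for p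
  proof (cases "range (fst p) \<subseteq> H")
    case False
    then have "\<rho> p = id" unfolding \<rho>_def by (intro ext) (simp only: if_False id_apply)
    then show ?thesis by simp
  next
    case True
    obtain u g where [simp]: "p = (u, g)" by (cases p)
    have g: "g \<in> carrier G" using p wreath_carrierD(1) by simp
    have into: "\<rho> p ` \<Psi> \<subseteq> \<Psi>"
      using True g \<sigma>\<Omega> lampH by (auto simp: \<rho>_def \<Psi>_def intro!: subgroup.m_closed[OF H(1)])
    \<comment> \<open>Injectivity is enough, because \<open>\<Psi>\<close> is finite and mapped into
      itself.\<close>
    have "inj_on (\<rho> p) \<Psi>"
    proof (rule inj_onI)
      fix z z' assume z: "z \<in> \<Psi>" "z' \<in> \<Psi>" and eq: "\<rho> p z = \<rho> p z'"
      obtain \<phi> x \<phi>' x' where [simp]: "z = (\<phi>, x)" "z' = (\<phi>', x')" by (cases z, cases z')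
      have "\<sigma> g x = \<sigma> g x'" using eq True by (simp add: \<rho>_def)
      then have x: "x' = x"
        using bij[OF g] z by (auto simp: \<Psi>_def bij_betw_def dest: inj_onD)
      have "\<phi> y = \<phi>' y" if y: "y \<in> \<Omega>" for y
      proof -
        have "\<phi> y \<otimes>\<^bsub>B\<^esub> lamp \<sigma> u g x y = \<phi>' y \<otimes>\<^bsub>B\<^esub> lamp \<sigma> u g x y"
          using eq True y fun_cong[of "restrict _ \<Omega>" "restrict _ \<Omega>" y] by (simp add: \<rho>_def x)
        moreover have "\<phi> y \<in> carrier B" "\<phi>' y \<in> carrier B"
          using z y HB by (auto simp: \<Psi>_def dest: PiE_mem)
        moreover have "lamp \<sigma> u g x y \<in> carrier B" using lamp_closed p by simp
        ultimately show ?thesis by simp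
      qed
      then have "\<phi> = \<phi>'" using z by (intro PiE_ext[of _ \<Omega> "\<lambda>_. H"]) (auto simp: \<Psi>_def)
      then show "z = z'" by (simp add: x)
    qed
    then show ?thesis using endo_inj_surj[OF fin\<Psi> into] by (simp add: bij_betw_def)
  qed
  have "\<rho> (p \<otimes>\<^bsub>?W\<^esub> q) z = \<rho> p (\<rho> q z)"
    if z: "z \<in> \<Psi> - (\<Omega> \<rightarrow>\<^sub>E H) \<times> A" and pq: "p \<in> E" "q \<in> E" for z p q
  proof -
    obtain u g v h \<phi> x where [simp]: "p = (u, g)" "q = (v, h)" "z = (\<phi>, x)" by (cases p, cases q, cases z)
    have x: "x \<in> \<Omega> - A" and \<phi>: "\<phi> \<in> \<Omega> \<rightarrow>\<^sub>E H" using z by (auto simp: \<Psi>_def)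
    have inP: "(u, g) \<in> P" "(v, h) \<in> P" and inW: "(u, g) \<in> carrier ?W" "(v, h) \<in> carrier ?W"
      using pq P by (auto simp: P_def)
    note c = wreath_carrierD[OF inW(1)] wreath_carrierD[OF inW(2)]
    obtain w j where wj: "(u, g) \<otimes>\<^bsub>?W\<^esub> (v, h) = (w, j)" by (cases "(u, g) \<otimes>\<^bsub>?W\<^esub> (v, h)")
    have uv: "u k \<in> H" "v k \<in> H" for k using uH[OF inP(1)] uH[OF inP(2)] by auto
    then have wH: "range w \<subseteq> H"
      using wj subgroup.one_closed[OF H(1)] subgroup.m_closed[OF H(1) uv] by (auto simp: mult_wreath)
    have j: "j = g \<otimes>\<^bsub>G\<^esub> h" using wj by (simp add: mult_wreath)
    have \<sigma>j: "\<sigma> j x = \<sigma> g (\<sigma> h x)" using mult[OF x] TI inP by (auto simp: j)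
    have \<phi>B: "\<phi> y \<in> carrier B" if "y \<in> \<Omega>" for y using PiE_mem[OF \<phi> that] HB by auto
    have lB: "lamp \<sigma> u g (\<sigma> h x) y \<in> carrier B" "lamp \<sigma> v h x y \<in> carrier B" for y
      by (rule lamp_closed, rule inW)+
    have l: "lamp \<sigma> w j x y = lamp \<sigma> v h x y \<otimes>\<^bsub>B\<^esub> lamp \<sigma> u g (\<sigma> h x) y" for y
      using inW wj mult[OF x TI(4)[OF inP(1)] TI(1)[OF inP(2)]] by (intro lamp_mult) auto
    have "\<rho> p (\<rho> q z) = (\<lambda>y\<in>\<Omega>. \<phi> y \<otimes>\<^bsub>B\<^esub> lamp \<sigma> v h x y \<otimes>\<^bsub>B\<^esub> lamp \<sigma> u g (\<sigma> h x) y, \<sigma> g (\<sigma> h x))"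
      using uH[OF inP(1)] uH[OF inP(2)] by (auto simp: \<rho>_def)
    also have "\<dots> = (\<lambda>y\<in>\<Omega>. \<phi> y \<otimes>\<^bsub>B\<^esub> lamp \<sigma> w j x y, \<sigma> j x)"
      using \<phi>B lB
      by (auto simp: l \<sigma>j L.m_assoc intro!: restrict_ext)
    also have "\<dots> = \<rho> (p \<otimes>\<^bsub>?W\<^esub> q) z" using wH by (simp add: wj \<rho>_def)
    finally show ?thesis ..
  qed
  \<comment> \<open>If \<open>g\<close> is nontrivial, the position moves. Otherwise some lamp
    \<open>k0\<close> is lit, and the site \<open>y\<close> that it reaches receives exactly
    \<open>u k0\<close>, so the configuration changes there.\<close>
  moreover have "\<rho> p z \<noteq> z" if z: "z \<in> \<Psi> - (\<Omega> \<rightarrow>\<^sub>E H) \<times> A" and p: "p \<in> D" for z p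
  proof
    assume fp: "\<rho> p z = z"
    obtain u g \<phi> x where [simp]: "p = (u, g)" "z = (\<phi>, x)" by (cases p, cases z)
    have x: "x \<in> \<Omega> - A" and \<phi>: "\<phi> \<in> \<Omega> \<rightarrow>\<^sub>E H" using z by (auto simp: \<Psi>_def)
    have inP: "(u, g) \<in> P" and inW: "(u, g) \<in> carrier ?W" and ne: "(u, g) \<noteq> \<one>\<^bsub>?W\<^esub>"
      using p P ED by (auto simp: P_def)
    note c = wreath_carrierD[OF inW]
    have e: "(\<lambda>y\<in>\<Omega>. \<phi> y \<otimes>\<^bsub>B\<^esub> lamp \<sigma> u g x y) = \<phi>" "\<sigma> g x = x"
      using fp uH[OF inP] by (auto simp: \<rho>_def)
    have "g \<notin> T'" using free[OF x] e by auto
    then have g: "g = \<one>\<^bsub>G\<^esub>" using TI(1)[OF inP] by (auto simp: T'_def)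
    then obtain k0 where k0: "k0 \<in> supp u" using ne by (auto simp: one_wreath)
    then have k0G: "k0 \<in> carrier G" using c by auto
    define y where "y = \<sigma> (inv\<^bsub>G\<^esub> k0) x"
    have y: "y \<in> \<Omega>" using k0G x \<sigma>\<Omega> by (simp add: y_def)
    have "\<phi> y \<otimes>\<^bsub>B\<^esub> lamp \<sigma> u g x y = \<phi> y" using fun_cong[OF e(1), of y] y by simp
    moreover have "\<phi> y \<in> carrier B" using PiE_mem[OF \<phi> y] HB by auto
    moreover have "lamp \<sigma> u g x y \<in> carrier B" using inW by (rule lamp_closed)
    ultimately have triv: "lamp \<sigma> u g x y = \<one>\<^bsub>B\<^esub>" by simp
    have "\<sigma> \<one>\<^bsub>G\<^esub> (\<sigma> \<one>\<^bsub>G\<^esub> x) = \<sigma> \<one>\<^bsub>G\<^esub> x"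
      using mult[OF x, of "\<one>\<^bsub>G\<^esub>" "\<one>\<^bsub>G\<^esub>"] TI(5)[OF inP] by simp
    \<comment> \<open>Injectivity of \<open>\<sigma> \<one>\<close> cancels one application.\<close>
    then have \<sigma>1: "\<sigma> \<one>\<^bsub>G\<^esub> x = x"
      using bij[OF G.one_closed] x \<sigma>\<Omega>[OF G.one_closed, of x] by (auto simp: bij_betw_def dest: inj_onD)
    \<comment> \<open>Two lamps landing on one site would make the permutation for
      \<open>k \<otimes> inv k0\<close> act on \<open>x\<close> like that for
      \<open>k \<otimes> inv k\<close>, hence fix \<open>x\<close>, against freeness.\<close>
    have "k0 = k" if k: "k \<in> supp u" and eq: "\<sigma> (inv\<^bsub>G\<^esub> k) x = y" for k
    proof (rule ccontr)
      assume ne: "k0 \<noteq> k"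
      have kG: "k \<in> carrier G" using k c by auto
      have "k \<otimes>\<^bsub>G\<^esub> inv\<^bsub>G\<^esub> k0 \<noteq> \<one>\<^bsub>G\<^esub>" using ne kG k0G by (metis G.inv_equality G.inv_inv G.inv_closed)
      moreover have "k \<otimes>\<^bsub>G\<^esub> inv\<^bsub>G\<^esub> k0 \<in> (\<lambda>(a, b). a \<otimes>\<^bsub>G\<^esub> inv\<^bsub>G\<^esub> b) ` (T \<times> T)"
        using TI(2)[OF inP k] TI(2)[OF inP k0] by force
      ultimately have "k \<otimes>\<^bsub>G\<^esub> inv\<^bsub>G\<^esub> k0 \<in> T'" by (auto simp: T'_def)
      moreover have "\<sigma> (k \<otimes>\<^bsub>G\<^esub> inv\<^bsub>G\<^esub> k0) x = \<sigma> (k \<otimes>\<^bsub>G\<^esub> inv\<^bsub>G\<^esub> k) x"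
        using mult[OF x TI(2)[OF inP k] TI(3)[OF inP k0]] mult[OF x TI(2)[OF inP k] TI(3)[OF inP k]] eq
        by (simp add: y_def)
      ultimately show False using free[OF x] \<sigma>1 kG by simp
    qed
    then have "lamp \<sigma> u g x y = finprod B (\<lambda>k. if k0 = k then u k else \<one>\<^bsub>B\<^esub>) (supp u)"
      unfolding lamp_def using c by (intro L.finprod_cong') (auto simp: g y_def subset_iff)
    also have "\<dots> = u k0" using c k0 by (intro L.finprod_singleton) auto
    finally show False using triv k0 by simp
  qed
  \<comment> \<open>The exceptional set is a full preimage of \<open>A\<close> under the projection
    to positions, so its proportion is that of \<open>A\<close> in \<open>\<Omega>\<close>.\<close>
  moreover have "real (card ((\<Omega> \<rightarrow>\<^sub>E H) \<times> A)) \<le> \<epsilon> * real (card \<Psi>)"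
    using mult_left_mono[OF A(2), of "real (card (\<Omega> \<rightarrow>\<^sub>E H))"]
    by (simp add: \<Psi>_def card_cartesian_product mult_ac)
  moreover have "(\<Omega> \<rightarrow>\<^sub>E H) \<times> A \<subseteq> \<Psi>" using A(1) by (auto simp: \<Psi>_def)
  ultimately have "perm_approx ?W E D \<epsilon> \<Psi> \<rho>"
    unfolding perm_approx_def using fin\<Psi> \<open>\<Psi> \<noteq> {}\<close> bij\<rho> by blast
  then show "\<exists>m>0. \<exists>\<rho>. perm_approx ?W E D \<epsilon> {1..m::nat} \<rho> \<and> (\<forall>p\<in>carrier ?W. \<rho> p permutes {1..m})"
    using ED by (intro perm_approx_transport group_wreath) auto
qed


section \<open>Quadratic maps\<close>

lemma (in group) solve_conj:
  assumes "a \<otimes> d = b \<otimes> d \<otimes> e" "a \<in> carrier G" "b \<in> carrier G" "d \<in> carrier G" "e \<in> carrier G"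
  shows "inv b \<otimes> a = d \<otimes> e \<otimes> inv d"
proof -
  have "a = b \<otimes> (d \<otimes> e \<otimes> inv d)"
    using assms by (metis inv_closed inv_solve_right m_assoc m_closed)
  then show ?thesis using assms by (simp add: m_assoc[symmetric])
qed

text \<open>Third differences are evaluated at \<one>, exactly as in the relators of
  \<open>Pol\<close>; letting the outermost direction vary recovers the other base points.\<close>

locale quadratic_map = G: group G + H: group H
  for G :: "('a, 'b) monoid_scheme" (structure) and H :: "('c, 'd) monoid_scheme" (structure) +
  fixes f :: "'a \<Rightarrow> 'c"
  assumes f_closed [simp]: "g \<in> carrier G \<Longrightarrow> f g \<in> carrier H"
    and f_one [simp]: "f \<one>\<^bsub>G\<^esub> = \<one>\<^bsub>H\<^esub>"
    and diff3: "\<lbrakk>k \<in> carrier G; g \<in> carrier G; h \<in> carrier G\<rbrakk> \<Longrightarrow>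
      group_diffs G H [k, g, h] f \<one>\<^bsub>G\<^esub> = \<one>\<^bsub>H\<^esub>"
begin

definition d :: "'a \<Rightarrow> 'a \<Rightarrow> 'c" where
  "d h x = f (h \<otimes>\<^bsub>G\<^esub> x) \<otimes>\<^bsub>H\<^esub> inv\<^bsub>H\<^esub> f x"

text \<open>The second difference of \<open>f\<close> at \<one>, with outer direction
  \<open>g\<close> and inner direction \<open>h\<close>. Since \<open>f\<close> is normalised at
  \<one>, it measures the failure of multiplicativity on \<open>h \<otimes> g\<close>.\<close>

definition c :: "'a \<Rightarrow> 'a \<Rightarrow> 'c" where
  "c g h = d h g \<otimes>\<^bsub>H\<^esub> inv\<^bsub>H\<^esub> d h \<one>\<^bsub>G\<^esub>"

lemma d_closed [simp]: "h \<in> carrier G \<Longrightarrow> x \<in> carrier G \<Longrightarrow> d h x \<in> carrier H"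
  by (simp add: d_def)

lemma c_closed [simp]: "g \<in> carrier G \<Longrightarrow> h \<in> carrier G \<Longrightarrow> c g h \<in> carrier H"
  by (simp add: c_def)

lemma d_one [simp]: "h \<in> carrier G \<Longrightarrow> d h \<one>\<^bsub>G\<^esub> = f h"
  by (simp add: d_def)

lemma c_one_right [simp]: "g \<in> carrier G \<Longrightarrow> c g \<one>\<^bsub>G\<^esub> = \<one>\<^bsub>H\<^esub>"
  by (simp add: c_def d_def)

text \<open>The third difference in the directions \<open>x\<close>, \<open>g\<close>,
  \<open>h\<close> compares the second difference at \<open>x\<close> with the one at \<one>, so its
  vanishing says that second differences do not depend on the base point.\<close>

lemma d_mult:
  assumes "g \<in> carrier G" "h \<in> carrier G" "x \<in> carrier G"
  shows "d h (g \<otimes>\<^bsub>G\<^esub> x) = c g h \<otimes>\<^bsub>H\<^esub> d h x"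
proof -
  have "d h (g \<otimes>\<^bsub>G\<^esub> x) \<otimes>\<^bsub>H\<^esub> inv\<^bsub>H\<^esub> d h x \<otimes>\<^bsub>H\<^esub> inv\<^bsub>H\<^esub> c g h = \<one>\<^bsub>H\<^esub>"
    using diff3[of x g h] assms by (simp add: group_diffs_def group_diff_def c_def d_def)
  then have "d h (g \<otimes>\<^bsub>G\<^esub> x) \<otimes>\<^bsub>H\<^esub> inv\<^bsub>H\<^esub> d h x = c g h"
    using assms by (simp add: H.inv_solve_right')
  then show ?thesis using assms by (simp add: H.inv_solve_right')
qed

lemma d_eq: "h \<in> carrier G \<Longrightarrow> x \<in> carrier G \<Longrightarrow> d h x = c x h \<otimes>\<^bsub>H\<^esub> f h"
  using d_mult[of x h "\<one>\<^bsub>G\<^esub>"] by simp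

lemma f_mult:
  assumes "h \<in> carrier G" "x \<in> carrier G"
  shows "f (h \<otimes>\<^bsub>G\<^esub> x) = c x h \<otimes>\<^bsub>H\<^esub> f h \<otimes>\<^bsub>H\<^esub> f x"
proof -
  have "f (h \<otimes>\<^bsub>G\<^esub> x) = d h x \<otimes>\<^bsub>H\<^esub> f x" using assms by (simp add: d_def H.m_assoc)
  then show ?thesis using assms by (simp add: d_eq)
qed

text \<open>Apply \<open>d_mult\<close> at the base point \<open>g'\<close> and cancel
  \<open>f h\<close>.\<close>

lemma c_mult_left:
  assumes "g \<in> carrier G" "g' \<in> carrier G" "h \<in> carrier G"
  shows "c (g \<otimes>\<^bsub>G\<^esub> g') h = c g h \<otimes>\<^bsub>H\<^esub> c g' h"
proof -
  have "c (g \<otimes>\<^bsub>G\<^esub> g') h \<otimes>\<^bsub>H\<^esub> f h = c g h \<otimes>\<^bsub>H\<^esub> c g' h \<otimes>\<^bsub>H\<^esub> f h"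
    using d_mult[of g h g'] assms by (simp add: d_eq H.m_assoc)
  then show ?thesis using assms by simp
qed

lemma c_hom: "h \<in> carrier G \<Longrightarrow> (\<lambda>g. c g h) \<in> hom G H"
  by (rule homI) (auto simp: c_mult_left)

lemma c_inv_left: "g \<in> carrier G \<Longrightarrow> h \<in> carrier G \<Longrightarrow> c (inv\<^bsub>G\<^esub> g) h = inv\<^bsub>H\<^esub> c g h"
  using group_hom.hom_inv[of G H "\<lambda>g. c g h" g] c_hom
  by (simp add: group_hom_def group_hom_axioms_def G.group_axioms H.group_axioms)

text \<open>The difference along \<open>h \<otimes> h'\<close> at \<open>g \<otimes> x\<close> is
  expanded twice, extracting \<open>g\<close> before or after splitting the direction. The left side
  is free of \<open>x\<close>, which is what \<open>c_comm_conj\<close> exploits.\<close>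

lemma c_mult_right_aux:
  assumes "g \<in> carrier G" "h \<in> carrier G" "h' \<in> carrier G" "x \<in> carrier G"
  shows "inv\<^bsub>H\<^esub> (c h' h \<otimes>\<^bsub>H\<^esub> c g h) \<otimes>\<^bsub>H\<^esub> (c g (h \<otimes>\<^bsub>G\<^esub> h') \<otimes>\<^bsub>H\<^esub> c h' h) =
    d h x \<otimes>\<^bsub>H\<^esub> c g h' \<otimes>\<^bsub>H\<^esub> inv\<^bsub>H\<^esub> d h x"
proof (rule H.solve_conj)
  \<comment> \<open>Insert \<open>f (h' \<otimes> y)\<close> between the two ends of the difference,
    then extract \<open>h'\<close> by \<open>d_mult\<close>.\<close>
  have dd: "d (h \<otimes>\<^bsub>G\<^esub> h') y = c h' h \<otimes>\<^bsub>H\<^esub> d h y \<otimes>\<^bsub>H\<^esub> d h' y" if "y \<in> carrier G" for y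
  proof -
    have "d (h \<otimes>\<^bsub>G\<^esub> h') y = d h (h' \<otimes>\<^bsub>G\<^esub> y) \<otimes>\<^bsub>H\<^esub> d h' y"
      using assms that by (simp add: d_def G.m_assoc H.m_assoc H.inv_solve_left)
    then show ?thesis using assms that by (simp add: d_mult)
  qed
  have "c g (h \<otimes>\<^bsub>G\<^esub> h') \<otimes>\<^bsub>H\<^esub> c h' h \<otimes>\<^bsub>H\<^esub> d h x \<otimes>\<^bsub>H\<^esub> d h' x = d (h \<otimes>\<^bsub>G\<^esub> h') (g \<otimes>\<^bsub>G\<^esub> x)"
    using assms by (subst d_mult) (auto simp: dd H.m_assoc)
  also have "\<dots> = c h' h \<otimes>\<^bsub>H\<^esub> c g h \<otimes>\<^bsub>H\<^esub> d h x \<otimes>\<^bsub>H\<^esub> c g h' \<otimes>\<^bsub>H\<^esub> d h' x"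
    using assms by (subst dd) (auto simp: d_mult H.m_assoc)
  finally show "c g (h \<otimes>\<^bsub>G\<^esub> h') \<otimes>\<^bsub>H\<^esub> c h' h \<otimes>\<^bsub>H\<^esub> d h x = c h' h \<otimes>\<^bsub>H\<^esub> c g h \<otimes>\<^bsub>H\<^esub> d h x \<otimes>\<^bsub>H\<^esub> c g h'"
    using assms by simp
qed (use assms in auto)

text \<open>The conjugates of \<open>c g h'\<close> by \<open>d h x\<close> and by
  \<open>d h \<one>\<close> agree by \<open>c_mult_right_aux\<close>, and \<open>d h x\<close> is
  \<open>c x h \<otimes> f h\<close>.\<close>

lemma c_comm_conj:
  assumes "x \<in> carrier G" "g \<in> carrier G" "h \<in> carrier G" "h' \<in> carrier G"
  shows "c x h \<otimes>\<^bsub>H\<^esub> (f h \<otimes>\<^bsub>H\<^esub> c g h' \<otimes>\<^bsub>H\<^esub> inv\<^bsub>H\<^esub> f h) = f h \<otimes>\<^bsub>H\<^esub> c g h' \<otimes>\<^bsub>H\<^esub> inv\<^bsub>H\<^esub> f h \<otimes>\<^bsub>H\<^esub> c x h"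
proof -
  have "d h x \<otimes>\<^bsub>H\<^esub> c g h' \<otimes>\<^bsub>H\<^esub> inv\<^bsub>H\<^esub> d h x = f h \<otimes>\<^bsub>H\<^esub> c g h' \<otimes>\<^bsub>H\<^esub> inv\<^bsub>H\<^esub> f h"
    using c_mult_right_aux[of g h h' x] c_mult_right_aux[of g h h' "\<one>\<^bsub>G\<^esub>"] assms by simp
  then have "c x h \<otimes>\<^bsub>H\<^esub> (f h \<otimes>\<^bsub>H\<^esub> c g h' \<otimes>\<^bsub>H\<^esub> inv\<^bsub>H\<^esub> f h) \<otimes>\<^bsub>H\<^esub> inv\<^bsub>H\<^esub> c x h = f h \<otimes>\<^bsub>H\<^esub> c g h' \<otimes>\<^bsub>H\<^esub> inv\<^bsub>H\<^esub> f h"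
    using assms by (simp add: d_eq H.m_assoc H.inv_mult_group)
  then show ?thesis using assms by (simp add: H.inv_solve_right')
qed

text \<open>Put \<open>x = \<one>\<close> in \<open>c_mult_right_aux\<close>, move the inverse of
  \<open>c h' h\<close> past the conjugate by \<open>c_comm_conj\<close>, and collect the factors by
  multiplicativity on the left.\<close>

lemma c_mult_right_conj:
  assumes "g \<in> carrier G" "h \<in> carrier G" "h' \<in> carrier G"
  shows "c g (h \<otimes>\<^bsub>G\<^esub> h') = c (h' \<otimes>\<^bsub>G\<^esub> g \<otimes>\<^bsub>G\<^esub> inv\<^bsub>G\<^esub> h') h \<otimes>\<^bsub>H\<^esub> (f h \<otimes>\<^bsub>H\<^esub> c g h' \<otimes>\<^bsub>H\<^esub> inv\<^bsub>H\<^esub> f h)"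
proof -
  let ?K = "f h \<otimes>\<^bsub>H\<^esub> c g h' \<otimes>\<^bsub>H\<^esub> inv\<^bsub>H\<^esub> f h"
  have K: "?K \<in> carrier H" using assms by simp
  have "c g (h \<otimes>\<^bsub>G\<^esub> h') \<otimes>\<^bsub>H\<^esub> c h' h = c h' h \<otimes>\<^bsub>H\<^esub> c g h \<otimes>\<^bsub>H\<^esub> ?K"
    using c_mult_right_aux[of g h h' "\<one>\<^bsub>G\<^esub>"] assms K by (simp add: H.inv_solve_left')
  then have "c g (h \<otimes>\<^bsub>G\<^esub> h') = c h' h \<otimes>\<^bsub>H\<^esub> c g h \<otimes>\<^bsub>H\<^esub> ?K \<otimes>\<^bsub>H\<^esub> inv\<^bsub>H\<^esub> c h' h"
    using assms K by (simp add: H.inv_solve_right)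
  also have "\<dots> = c h' h \<otimes>\<^bsub>H\<^esub> c g h \<otimes>\<^bsub>H\<^esub> (?K \<otimes>\<^bsub>H\<^esub> c (inv\<^bsub>G\<^esub> h') h)"
    using assms K by (simp only: c_inv_left H.m_assoc H.m_closed c_closed H.inv_closed)
  also have "\<dots> = c h' h \<otimes>\<^bsub>H\<^esub> c g h \<otimes>\<^bsub>H\<^esub> (c (inv\<^bsub>G\<^esub> h') h \<otimes>\<^bsub>H\<^esub> ?K)"
    using assms by (subst c_comm_conj) auto
  also have "\<dots> = c h' h \<otimes>\<^bsub>H\<^esub> c g h \<otimes>\<^bsub>H\<^esub> c (inv\<^bsub>G\<^esub> h') h \<otimes>\<^bsub>H\<^esub> ?K"
    using assms K by (simp only: H.m_assoc H.m_closed c_closed G.inv_closed)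
  finally show ?thesis using assms by (simp only: c_mult_left G.m_closed G.inv_closed)
qed

text \<open>For \<open>h' = inv h\<close>, \<open>c_mult_right_conj\<close> says that \<open>f h\<close> conjugates the values \<open>c _ (inv h)\<close>
  onto the values \<open>c _ h\<close>, so \<open>c_comm_conj\<close> upgrades to commutation of all values of \<open>c\<close>.\<close>

lemma c_comm:
  assumes "x \<in> carrier G" "h \<in> carrier G" "g \<in> carrier G" "h' \<in> carrier G"
  shows "c x h \<otimes>\<^bsub>H\<^esub> c g h' = c g h' \<otimes>\<^bsub>H\<^esub> c x h"
proof -
  define k where "k = inv\<^bsub>G\<^esub> h"
  define y where "y = inv\<^bsub>G\<^esub> (h \<otimes>\<^bsub>G\<^esub> x \<otimes>\<^bsub>G\<^esub> inv\<^bsub>G\<^esub> h)"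
  have ky: "k \<in> carrier G" "y \<in> carrier G" "inv\<^bsub>G\<^esub> y \<in> carrier G" using assms by (auto simp: k_def y_def)
  let ?K = "f k \<otimes>\<^bsub>H\<^esub> c x h \<otimes>\<^bsub>H\<^esub> inv\<^bsub>H\<^esub> f k" and ?L = "f k \<otimes>\<^bsub>H\<^esub> c g h' \<otimes>\<^bsub>H\<^esub> inv\<^bsub>H\<^esub> f k"
  have KL: "?K \<in> carrier H" "?L \<in> carrier H" using assms ky by auto
  have "c (inv\<^bsub>G\<^esub> y) k \<otimes>\<^bsub>H\<^esub> ?K = \<one>\<^bsub>H\<^esub>"
    using c_mult_right_conj[of x k h] assms ky by (simp add: k_def y_def)
  then have "?K = c y k"
    using ky KL by (simp only: c_inv_left H.inv_solve_left' H.inv_closed c_closed H.r_one H.one_closed)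
  then have "?K \<otimes>\<^bsub>H\<^esub> ?L = ?L \<otimes>\<^bsub>H\<^esub> ?K" using c_comm_conj[of y g k h'] ky assms by simp
  moreover have cancel: "inv\<^bsub>H\<^esub> f k \<otimes>\<^bsub>H\<^esub> (f k \<otimes>\<^bsub>H\<^esub> z) = z" if "z \<in> carrier H" for z
    using that ky by (simp add: H.m_assoc[symmetric])
  have "?K \<otimes>\<^bsub>H\<^esub> ?L = f k \<otimes>\<^bsub>H\<^esub> (c x h \<otimes>\<^bsub>H\<^esub> c g h') \<otimes>\<^bsub>H\<^esub> inv\<^bsub>H\<^esub> f k"
    "?L \<otimes>\<^bsub>H\<^esub> ?K = f k \<otimes>\<^bsub>H\<^esub> (c g h' \<otimes>\<^bsub>H\<^esub> c x h) \<otimes>\<^bsub>H\<^esub> inv\<^bsub>H\<^esub> f k"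
    using assms ky cancel by (simp_all add: H.m_assoc)
  ultimately show ?thesis using assms ky by simp
qed

text \<open>Once the values of \<open>c\<close> commute, \<open>c _ h\<close> does not see the
  conjugation by \<open>h'\<close>. What remains is the cocycle identity for the action of
  \<open>f h\<close> by conjugation.\<close>

lemma c_mult_right:
  assumes "g \<in> carrier G" "h \<in> carrier G" "h' \<in> carrier G"
  shows "c g (h \<otimes>\<^bsub>G\<^esub> h') = c g h \<otimes>\<^bsub>H\<^esub> (f h \<otimes>\<^bsub>H\<^esub> c g h' \<otimes>\<^bsub>H\<^esub> inv\<^bsub>H\<^esub> f h)"
proof -
  have "c (h' \<otimes>\<^bsub>G\<^esub> g \<otimes>\<^bsub>G\<^esub> inv\<^bsub>G\<^esub> h') h = c h' h \<otimes>\<^bsub>H\<^esub> c g h \<otimes>\<^bsub>H\<^esub> inv\<^bsub>H\<^esub> c h' h"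
    using assms by (simp add: c_mult_left c_inv_left)
  also have "\<dots> = c g h" using assms by (simp add: c_comm[of h' h g h] H.m_assoc)
  finally show ?thesis using c_mult_right_conj[OF assms] by simp
qed

section \<open>Rewriting rules that lead to normal forms\<close>

lemma f_conj:
  assumes "g \<in> carrier G" "h \<in> carrier G" "k \<in> carrier G"
  shows "f k \<otimes>\<^bsub>H\<^esub> c g h = c g (k \<otimes>\<^bsub>G\<^esub> h) \<otimes>\<^bsub>H\<^esub> c (inv\<^bsub>G\<^esub> g) k \<otimes>\<^bsub>H\<^esub> f k"
proof -
  \<comment> \<open>This is the cocycle identity solved for the conjugate of \<open>c g h\<close> by
    \<open>f k\<close>; the two values of \<open>c\<close> are swapped to bring the inverse next to
    its factor.\<close>
  have "c g (k \<otimes>\<^bsub>G\<^esub> h) \<otimes>\<^bsub>H\<^esub> c (inv\<^bsub>G\<^esub> g) k = c (inv\<^bsub>G\<^esub> g) k \<otimes>\<^bsub>H\<^esub> c g (k \<otimes>\<^bsub>G\<^esub> h)"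
    using assms by (intro c_comm) auto
  also have "\<dots> = f k \<otimes>\<^bsub>H\<^esub> c g h \<otimes>\<^bsub>H\<^esub> inv\<^bsub>H\<^esub> f k"
    using assms by (simp add: c_mult_right c_inv_left H.m_assoc[symmetric])
  finally show ?thesis using assms by (simp add: H.m_assoc)
qed

text \<open>From \<open>f_mult\<close> for the product of \<open>inv k\<close> and \<open>k\<close>.
  It removes inverses of generators from words.\<close>

lemma f_inv:
  assumes "k \<in> carrier G"
  shows "inv\<^bsub>H\<^esub> f k = c k (inv\<^bsub>G\<^esub> k) \<otimes>\<^bsub>H\<^esub> f (inv\<^bsub>G\<^esub> k)"
  using f_mult[of "inv\<^bsub>G\<^esub> k" k] assms by (intro H.inv_equality) auto

text \<open>For fixed \<open>h\<close> this is a homomorphism with commuting values, so its kernel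
  contains all commutators.\<close>

lemma c_derived:
  assumes "g \<in> derived G (carrier G)" "h \<in> carrier G"
  shows "c g h = \<one>\<^bsub>H\<^esub>"
proof -
  interpret c: group_hom G H "\<lambda>g. c g h"
    using c_hom[OF assms(2)] by unfold_locales
  have "derived G (carrier G) \<subseteq> kernel G H (\<lambda>g. c g h)"
    unfolding derived_def
  proof (rule G.generate_subgroup_incl[OF _ c.subgroup_kernel], safe)
    fix x y assume xy: "x \<in> carrier G" "y \<in> carrier G"
    have "c x h \<otimes>\<^bsub>H\<^esub> c y h = c y h \<otimes>\<^bsub>H\<^esub> c x h" using xy assms by (intro c_comm)
    then show "x \<otimes>\<^bsub>G\<^esub> y \<otimes>\<^bsub>G\<^esub> inv\<^bsub>G\<^esub> x \<otimes>\<^bsub>G\<^esub> inv\<^bsub>G\<^esub> y \<in> kernel G H (\<lambda>g. c g h)"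
      using xy assms by (simp add: kernel_def c_mult_left c_inv_left H.m_assoc H.inv_solve_left)
  qed
  then show ?thesis using assms by (auto simp: kernel_def)
qed

text \<open>Products of values of \<open>c\<close> in which \<open>E\<close> records the second
  arguments. These are distinct and never \<one>, so that in a wreath product the lamp at such an
  \<open>h\<close> is lit by its own factor alone.\<close>

inductive nf :: "'a set \<Rightarrow> 'c \<Rightarrow> bool" where
  empty: "nf {} \<one>\<^bsub>H\<^esub>"
| insert: "nf (insert h E) (c g h \<otimes>\<^bsub>H\<^esub> n)"
    if "nf E n" "g \<in> carrier G" "h \<in> carrier G - {\<one>\<^bsub>G\<^esub>}" "h \<notin> E"

lemma nf_closed: "nf E n \<Longrightarrow> n \<in> carrier H"
  by (induction rule: nf.induct) auto

text \<open>Commute the new factor inwards until it meets the factor with the same \<open>h\<close>,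
  and merge the two by multiplicativity on the left.\<close>

lemma nf_c_mem:
  assumes "nf E n" "h \<in> E" "g \<in> carrier G"
  shows "nf E (c g h \<otimes>\<^bsub>H\<^esub> n)"
  using assms
proof (induction rule: nf.induct)
  case (insert E n g' h')
  note n = nf_closed[OF insert.hyps(1)]
  show ?case
  proof (cases "h = h'")
    case True
    then have "c g h \<otimes>\<^bsub>H\<^esub> (c g' h' \<otimes>\<^bsub>H\<^esub> n) = c (g \<otimes>\<^bsub>G\<^esub> g') h' \<otimes>\<^bsub>H\<^esub> n"
      using insert n by (simp add: c_mult_left H.m_assoc)
    then show ?thesis using nf.insert[OF insert.hyps(1), of "g \<otimes>\<^bsub>G\<^esub> g'" h'] insert by simp
  next
    case False
    then have h: "h \<in> E" using insert by simp
    have "E \<subseteq> carrier G"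
      using insert.hyps(1) by (induction rule: nf.induct) auto
    then have hG: "h \<in> carrier G" using h by blast
    then have "c g h \<otimes>\<^bsub>H\<^esub> (c g' h' \<otimes>\<^bsub>H\<^esub> n) = c g' h' \<otimes>\<^bsub>H\<^esub> (c g h \<otimes>\<^bsub>H\<^esub> n)"
      using insert n c_comm[of g h g' h'] by (simp add: H.m_assoc[symmetric])
    then show ?thesis using nf.insert[OF insert.IH[OF h insert.prems(2)], of g' h'] insert by simp
  qed
qed simp

lemma nf_c:
  assumes "nf E n" "g \<in> carrier G" "h \<in> carrier G"
  shows "\<exists>E. nf E (c g h \<otimes>\<^bsub>H\<^esub> n)"
proof -
  consider "h = \<one>\<^bsub>G\<^esub>" | "h \<in> E" | "h \<noteq> \<one>\<^bsub>G\<^esub>" "h \<notin> E" by blast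
  then show ?thesis
    using assms nf_closed[OF assms(1)] nf_c_mem[of E n h g] nf.insert[of E n g h] by cases auto
qed

text \<open>Passing \<open>f k\<close> through a factor turns it into two values of \<open>c\<close>
  by \<open>f_conj\<close>, and \<open>nf_c\<close> absorbs them; the set of second arguments
  changes on the way.\<close>

lemma nf_f:
  assumes "nf E n" "k \<in> carrier G"
  shows "\<exists>E n'. nf E n' \<and> f k \<otimes>\<^bsub>H\<^esub> n = n' \<otimes>\<^bsub>H\<^esub> f k"
  using assms
proof (induction rule: nf.induct)
  case empty
  then show ?case using nf.empty by fastforce
next
  case (insert E n g h)
  then obtain E' n' where n': "nf E' n'" "f k \<otimes>\<^bsub>H\<^esub> n = n' \<otimes>\<^bsub>H\<^esub> f k" by blast
  note cl = nf_closed[OF insert.hyps(1)] nf_closed[OF n'(1)]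
  obtain E1 where E1: "nf E1 (c (inv\<^bsub>G\<^esub> g) k \<otimes>\<^bsub>H\<^esub> n')"
    using nf_c[OF n'(1), of "inv\<^bsub>G\<^esub> g" k] insert by auto
  obtain E2 where "nf E2 (c g (k \<otimes>\<^bsub>G\<^esub> h) \<otimes>\<^bsub>H\<^esub> (c (inv\<^bsub>G\<^esub> g) k \<otimes>\<^bsub>H\<^esub> n'))"
    using nf_c[OF E1, of g "k \<otimes>\<^bsub>G\<^esub> h"] insert by auto
  moreover have "f k \<otimes>\<^bsub>H\<^esub> (c g h \<otimes>\<^bsub>H\<^esub> n) = f k \<otimes>\<^bsub>H\<^esub> c g h \<otimes>\<^bsub>H\<^esub> n"
    using insert cl by (simp add: H.m_assoc)
  then have "f k \<otimes>\<^bsub>H\<^esub> (c g h \<otimes>\<^bsub>H\<^esub> n) = c g (k \<otimes>\<^bsub>G\<^esub> h) \<otimes>\<^bsub>H\<^esub> (c (inv\<^bsub>G\<^esub> g) k \<otimes>\<^bsub>H\<^esub> n') \<otimes>\<^bsub>H\<^esub> f k"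
    using insert cl n'(2) by (simp add: f_conj H.m_assoc)
  ultimately show ?case by blast
qed

text \<open>The candidates for all elements of the polynomial group: closure under left
  multiplication by generators and their inverses will show that nothing else occurs.\<close>

definition span :: "'c set" where
  "span = {n \<otimes>\<^bsub>H\<^esub> f g | E n g. nf E n \<and> g \<in> carrier G}"

lemma one_in_span: "\<one>\<^bsub>H\<^esub> \<in> span"
  using nf.empty G.one_closed unfolding span_def by force

lemma span_c:
  assumes "w \<in> span" "g \<in> carrier G" "h \<in> carrier G"
  shows "c g h \<otimes>\<^bsub>H\<^esub> w \<in> span"
proof -
  obtain E n x where w: "w = n \<otimes>\<^bsub>H\<^esub> f x" "nf E n" "x \<in> carrier G" using assms by (auto simp: span_def)
  obtain E' where "nf E' (c g h \<otimes>\<^bsub>H\<^esub> n)" using nf_c w assms by blast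
  moreover have "c g h \<otimes>\<^bsub>H\<^esub> w = c g h \<otimes>\<^bsub>H\<^esub> n \<otimes>\<^bsub>H\<^esub> f x"
    using w assms nf_closed[OF w(2)] by (simp add: H.m_assoc)
  ultimately show ?thesis using w unfolding span_def by blast
qed

text \<open>Move \<open>f k\<close> past the normal form by \<open>nf_f\<close>, combine it with
  \<open>f g\<close> into \<open>c (inv g) k \<otimes> f (k \<otimes> g)\<close>, and bring the new
  factor to the front, where \<open>span_c\<close> absorbs it.\<close>

lemma span_f:
  assumes "w \<in> span" "k \<in> carrier G"
  shows "f k \<otimes>\<^bsub>H\<^esub> w \<in> span"
proof -
  obtain E n g where w: "w = n \<otimes>\<^bsub>H\<^esub> f g" "nf E n" "g \<in> carrier G" using assms by (auto simp: span_def)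
  obtain E' n' where n': "nf E' n'" "f k \<otimes>\<^bsub>H\<^esub> n = n' \<otimes>\<^bsub>H\<^esub> f k" using nf_f w assms by blast
  note cl = nf_closed[OF w(2)] nf_closed[OF n'(1)]
  have "f k \<otimes>\<^bsub>H\<^esub> f g = c (inv\<^bsub>G\<^esub> g) k \<otimes>\<^bsub>H\<^esub> f (k \<otimes>\<^bsub>G\<^esub> g)"
    using assms w by (simp add: f_mult c_inv_left H.m_assoc[symmetric])
  moreover have "n' \<otimes>\<^bsub>H\<^esub> c (inv\<^bsub>G\<^esub> g) k = c (inv\<^bsub>G\<^esub> g) k \<otimes>\<^bsub>H\<^esub> n'"
    using n'(1)
  proof (induction rule: nf.induct)
    case (insert E n a b)
    have "c a b \<otimes>\<^bsub>H\<^esub> c (inv\<^bsub>G\<^esub> g) k = c (inv\<^bsub>G\<^esub> g) k \<otimes>\<^bsub>H\<^esub> c a b"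
      using insert assms w by (intro c_comm) auto
    then have "c a b \<otimes>\<^bsub>H\<^esub> (c (inv\<^bsub>G\<^esub> g) k \<otimes>\<^bsub>H\<^esub> n) = c (inv\<^bsub>G\<^esub> g) k \<otimes>\<^bsub>H\<^esub> (c a b \<otimes>\<^bsub>H\<^esub> n)"
      using insert nf_closed[OF insert(1)] assms w by (simp add: H.m_assoc[symmetric])
    then show ?case
      using insert nf_closed[OF insert(1)] assms w by (simp add: H.m_assoc)
  qed (use assms w in auto)
  moreover have "f k \<otimes>\<^bsub>H\<^esub> w = f k \<otimes>\<^bsub>H\<^esub> n \<otimes>\<^bsub>H\<^esub> f g" using w cl assms by (simp add: H.m_assoc)
  then have "f k \<otimes>\<^bsub>H\<^esub> w = n' \<otimes>\<^bsub>H\<^esub> (f k \<otimes>\<^bsub>H\<^esub> f g)" using w cl assms n'(2) by (simp add: H.m_assoc)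
  ultimately have "f k \<otimes>\<^bsub>H\<^esub> w = c (inv\<^bsub>G\<^esub> g) k \<otimes>\<^bsub>H\<^esub> (n' \<otimes>\<^bsub>H\<^esub> f (k \<otimes>\<^bsub>G\<^esub> g))"
    using w cl assms by (simp add: H.m_assoc[symmetric])
  moreover have "n' \<otimes>\<^bsub>H\<^esub> f (k \<otimes>\<^bsub>G\<^esub> g) \<in> span" using n' w assms unfolding span_def by blast
  ultimately show ?thesis using span_c w assms by simp
qed

lemma span_f_inv:
  assumes "w \<in> span" "k \<in> carrier G"
  shows "inv\<^bsub>H\<^esub> f k \<otimes>\<^bsub>H\<^esub> w \<in> span"
proof -
  have "w \<in> carrier H" using assms nf_closed by (auto simp: span_def)
  then have "inv\<^bsub>H\<^esub> f k \<otimes>\<^bsub>H\<^esub> w = c k (inv\<^bsub>G\<^esub> k) \<otimes>\<^bsub>H\<^esub> (f (inv\<^bsub>G\<^esub> k) \<otimes>\<^bsub>H\<^esub> w)"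
    using assms by (simp add: f_inv H.m_assoc)
  then show ?thesis using assms span_c span_f by simp
qed

end


section \<open>The quadratic map into a wreath product\<close>

definition wreath_gen :: "('b, 'c) monoid_scheme \<Rightarrow> ('a, 'd) monoid_scheme \<Rightarrow> ('a \<Rightarrow> 'b) \<Rightarrow> 'a \<Rightarrow> ('a \<Rightarrow> 'b) \<times> 'a" where
  "wreath_gen B G \<pi> g = (\<lambda>k. if k = \<one>\<^bsub>G\<^esub> then \<pi> g else \<one>\<^bsub>B\<^esub>, g)"

locale wreath_quadratic = wreath_product B G
  for B :: "('b, 'c) monoid_scheme" (structure) and G :: "('a, 'd) monoid_scheme" (structure) +
  fixes \<pi>
  assumes \<pi>_hom: "\<pi> \<in> hom G B"
begin

abbreviation q :: "'a \<Rightarrow> ('a \<Rightarrow> 'b) \<times> 'a" where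
  "q \<equiv> wreath_gen B G \<pi>"

lemma \<pi>_closed [simp]: "g \<in> carrier G \<Longrightarrow> \<pi> g \<in> carrier B"
  using \<pi>_hom by (auto simp: hom_def)

lemma \<pi>_mult [simp]: "g \<in> carrier G \<Longrightarrow> h \<in> carrier G \<Longrightarrow> \<pi> (g \<otimes>\<^bsub>G\<^esub> h) = \<pi> g \<otimes>\<^bsub>B\<^esub> \<pi> h"
  using \<pi>_hom by (auto simp: hom_def)

lemma \<pi>_one [simp]: "\<pi> \<one>\<^bsub>G\<^esub> = \<one>\<^bsub>B\<^esub>"
  using hom_one[OF \<pi>_hom] by (simp add: L.group_axioms G.group_axioms)

lemma q_closed: "g \<in> carrier G \<Longrightarrow> q g \<in> carrier (wreath B G)"
  unfolding wreath_gen_def by (rule wreath_carrierI[where S = "{\<one>\<^bsub>G\<^esub>}"]) auto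

lemma q_one: "q \<one>\<^bsub>G\<^esub> = \<one>\<^bsub>wreath B G\<^esub>"
  by (auto simp: wreath_gen_def one_wreath)

text \<open>The common shape of the first and second differences of \<open>q\<close>. Writing it as
  a product of two lamps also covers \<open>h = \<one>\<close>, where both sit on the same
  site.\<close>

definition bilamp :: "'b \<Rightarrow> 'b \<Rightarrow> 'a \<Rightarrow> 'a \<Rightarrow> ('a \<Rightarrow> 'b) \<times> 'a" where
  "bilamp b b' h g = (\<lambda>k. (if k = \<one>\<^bsub>G\<^esub> then b else \<one>\<^bsub>B\<^esub>) \<otimes>\<^bsub>B\<^esub> (if k = h then inv\<^bsub>B\<^esub> b' else \<one>\<^bsub>B\<^esub>), g)"

lemma bilamp_closed:
  assumes "b \<in> carrier B" "b' \<in> carrier B" "h \<in> carrier G" "g \<in> carrier G"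
  shows "bilamp b b' h g \<in> carrier (wreath B G)"
  unfolding bilamp_def using assms by (intro wreath_carrierI[where S = "{\<one>\<^bsub>G\<^esub>, h}"]) auto

lemma q_diff:
  assumes "h \<in> carrier G" "x \<in> carrier G"
  shows "q (h \<otimes>\<^bsub>G\<^esub> x) \<otimes>\<^bsub>wreath B G\<^esub> inv\<^bsub>wreath B G\<^esub> q x = bilamp (\<pi> (h \<otimes>\<^bsub>G\<^esub> x)) (\<pi> x) h h"
proof -
  interpret W: group "wreath B G" by (rule group_wreath)
  have "inv\<^bsub>G\<^esub> h \<otimes>\<^bsub>G\<^esub> k = \<one>\<^bsub>G\<^esub> \<longleftrightarrow> k = h" if "k \<in> carrier G" for k
    using assms that by (metis G.inv_closed G.inv_equality G.inv_inv G.l_inv)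
  then have "bilamp (\<pi> (h \<otimes>\<^bsub>G\<^esub> x)) (\<pi> x) h h \<otimes>\<^bsub>wreath B G\<^esub> q x = q (h \<otimes>\<^bsub>G\<^esub> x)"
    using assms by (auto simp: bilamp_def wreath_gen_def mult_wreath L.m_assoc)
  then show ?thesis
    using assms by (intro W.inv_solve_right'[THEN iffD2] bilamp_closed) (auto intro: q_closed bilamp_closed)
qed

text \<open>Since \<pi> is a homomorphism into an abelian group, the contributions of
  \<open>x\<close> cancel. The value is therefore independent of the base point, so third
  differences vanish.\<close>

lemma q_diff2:
  assumes "g \<in> carrier G" "h \<in> carrier G" "x \<in> carrier G"
  shows "group_diff G (wreath B G) g (group_diff G (wreath B G) h q) x = bilamp (\<pi> g) (\<pi> g) h \<one>\<^bsub>G\<^esub>"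
proof -
  interpret W: group "wreath B G" by (rule group_wreath)
  have "bilamp (\<pi> g) (\<pi> g) h \<one>\<^bsub>G\<^esub> \<otimes>\<^bsub>wreath B G\<^esub> bilamp (\<pi> (h \<otimes>\<^bsub>G\<^esub> x)) (\<pi> x) h h =
      bilamp (\<pi> (h \<otimes>\<^bsub>G\<^esub> (g \<otimes>\<^bsub>G\<^esub> x))) (\<pi> (g \<otimes>\<^bsub>G\<^esub> x)) h h"
    using assms by (auto simp: bilamp_def mult_wreath L.m_ac L.inv_mult)
  then show ?thesis
    unfolding group_diff_def using assms
    by (simp add: q_diff) (intro W.inv_solve_right'[THEN iffD2] bilamp_closed, auto)
qed

lemma q_diff3:
  assumes "k \<in> carrier G" "g \<in> carrier G" "h \<in> carrier G"
  shows "group_diffs G (wreath B G) [k, g, h] q \<one>\<^bsub>G\<^esub> = \<one>\<^bsub>wreath B G\<^esub>"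
proof -
  interpret W: group "wreath B G" by (rule group_wreath)
  have "group_diffs G (wreath B G) [k, g, h] q \<one>\<^bsub>G\<^esub> =
    group_diff G (wreath B G) k (group_diff G (wreath B G) g (group_diff G (wreath B G) h q)) \<one>\<^bsub>G\<^esub>"
    by (simp add: group_diffs_def)
  also have "\<dots> = \<one>\<^bsub>wreath B G\<^esub>"
    unfolding group_diff_def[of _ _ k] using assms by (simp add: q_diff2 bilamp_closed)
  finally show ?thesis .
qed

text \<open>Homomorphisms carry differences of \<open>f\<close> to differences of \<open>q\<close>,
  and \<open>c\<close> is a second difference.\<close>

lemma hom_c:
  assumes "quadratic_map G H f" "\<psi> \<in> hom H (wreath B G)" "\<And>g. g \<in> carrier G \<Longrightarrow> \<psi> (f g) = q g"
    and g: "g \<in> carrier G" "h \<in> carrier G"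
  shows "\<psi> (quadratic_map.c G H f g h) = bilamp (\<pi> g) (\<pi> g) h \<one>\<^bsub>G\<^esub>"
proof -
  interpret quadratic_map G H f by fact
  interpret \<psi>: group_hom H "wreath B G" \<psi>
    by (intro group_hom.intro group_hom_axioms.intro H.group_axioms group_wreath assms(2))
  have d: "\<psi> (d h x) = group_diff G (wreath B G) h q x" if "x \<in> carrier G" for x
    using that g assms(3) by (simp add: d_def group_diff_def)
  have "\<psi> (c g h) = group_diff G (wreath B G) g (group_diff G (wreath B G) h q) \<one>\<^bsub>G\<^esub>"
    unfolding c_def group_diff_def[of G "wreath B G" g] using g d by (simp del: d_one)
  then show ?thesis using g by (simp add: q_diff2)
qed

lemma hom_nf:
  assumes "quadratic_map G H f" "\<psi> \<in> hom H (wreath B G)" "\<And>g. g \<in> carrier G \<Longrightarrow> \<psi> (f g) = q g"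
    and "quadratic_map.nf G H f E n"
  shows "snd (\<psi> n) = \<one>\<^bsub>G\<^esub> \<and> (\<forall>k. k \<noteq> \<one>\<^bsub>G\<^esub> \<longrightarrow> k \<notin> E \<longrightarrow> fst (\<psi> n) k = \<one>\<^bsub>B\<^esub>)"
proof -
  interpret quadratic_map G H f by fact
  interpret \<psi>: group_hom H "wreath B G" \<psi>
    by (intro group_hom.intro group_hom_axioms.intro H.group_axioms group_wreath assms(2))
  show ?thesis using assms(4)
  proof (induction rule: nf.induct)
    case empty
    then show ?case by (simp add: one_wreath)
  next
    case (insert E n g h)
    obtain u x where ux: "\<psi> n = (u, x)" by (cases "\<psi> n")
    have n: "n \<in> carrier H" by (rule nf_closed) fact
    have "\<psi> (c g h \<otimes>\<^bsub>H\<^esub> n) = bilamp (\<pi> g) (\<pi> g) h \<one>\<^bsub>G\<^esub> \<otimes>\<^bsub>wreath B G\<^esub> (u, x)"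
      using insert n ux by (simp add: hom_c[OF assms(1-3)])
    then show ?case using insert ux by (auto simp: bilamp_def mult_wreath)
  qed
qed

text \<open>The factors inside \<open>n\<close> light lamps at \<one> and in \<open>E\<close>; as
  \<open>h\<close> is neither, the lamp there comes from the outermost factor.\<close>

lemma hom_nf_lamp:
  assumes "quadratic_map G H f" "\<psi> \<in> hom H (wreath B G)" "\<And>g. g \<in> carrier G \<Longrightarrow> \<psi> (f g) = q g"
    and "quadratic_map.nf G H f E n" "g \<in> carrier G" "h \<in> carrier G - {\<one>\<^bsub>G\<^esub>}" "h \<notin> E"
  shows "fst (\<psi> (quadratic_map.c G H f g h \<otimes>\<^bsub>H\<^esub> n)) h = inv\<^bsub>B\<^esub> \<pi> g"
proof -
  interpret quadratic_map G H f by fact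
  interpret \<psi>: group_hom H "wreath B G" \<psi>
    by (intro group_hom.intro group_hom_axioms.intro H.group_axioms group_wreath assms(2))
  obtain u x where ux: "\<psi> n = (u, x)" by (cases "\<psi> n")
  have "n \<in> carrier H" using assms(4) by (rule nf_closed)
  then have "\<psi> (c g h \<otimes>\<^bsub>H\<^esub> n) = bilamp (\<pi> g) (\<pi> g) h \<one>\<^bsub>G\<^esub> \<otimes>\<^bsub>wreath B G\<^esub> (u, x)"
    using assms(5,6) ux by (simp add: hom_c[OF assms(1-3)])
  then show ?thesis using hom_nf[OF assms(1-4)] assms(5-7) ux by (auto simp: bilamp_def mult_wreath)
qed

end

text \<open>Strip outer factors whose \<open>g\<close> lies in the derived subgroup, as they are
  trivial by \<open>c_derived\<close>. The first remaining one supplies \<open>a\<close>, and its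
  lamp at \<open>h\<close> survives whenever \<pi> does not kill \<open>a\<close>. The choice of
  \<open>a\<close> precedes that of \<open>B\<close> and \<pi>, so a torsion quotient can be built
  for it afterwards.\<close>

lemma (in quadratic_map) nf_separate:
  assumes "nf E n" "n \<noteq> \<one>\<^bsub>H\<^esub>"
  shows "\<exists>a\<in>carrier G - derived G (carrier G).
    \<forall>(B :: 'e monoid) \<pi> \<psi>. comm_group B \<longrightarrow> \<pi> \<in> hom G B \<longrightarrow> \<pi> a \<noteq> \<one>\<^bsub>B\<^esub> \<longrightarrow> \<psi> \<in> hom H (wreath B G) \<longrightarrow>
      (\<forall>g\<in>carrier G. \<psi> (f g) = wreath_gen B G \<pi> g) \<longrightarrow> \<psi> n \<noteq> \<one>\<^bsub>wreath B G\<^esub>"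
  using assms
proof (induction rule: nf.induct)
  case (insert E n g h)
  show ?case
  proof (cases "g \<in> derived G (carrier G)")
    case True
    then have "c g h \<otimes>\<^bsub>H\<^esub> n = n" using insert nf_closed by (simp add: c_derived)
    then show ?thesis using insert by metis
  next
    case False
    have "\<psi> (c g h \<otimes>\<^bsub>H\<^esub> n) \<noteq> \<one>\<^bsub>wreath B G\<^esub>"
      if B: "comm_group B" and \<pi>: "\<pi> \<in> hom G B" "\<pi> g \<noteq> \<one>\<^bsub>B\<^esub>" and \<psi>: "\<psi> \<in> hom H (wreath B G)"
        "\<forall>g\<in>carrier G. \<psi> (f g) = wreath_gen B G \<pi> g" for B :: "'e monoid" and \<pi> \<psi>
    proof
      interpret B: comm_group B by fact
      interpret wreath_quadratic B G \<pi> using \<pi>(1) by unfold_locales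
      assume "\<psi> (c g h \<otimes>\<^bsub>H\<^esub> n) = \<one>\<^bsub>wreath B G\<^esub>"
      then have "inv\<^bsub>B\<^esub> \<pi> g = \<one>\<^bsub>B\<^esub>"
        using hom_nf_lamp[OF quadratic_map_axioms \<psi>(1) _ insert.hyps] \<psi>(2) by (simp add: one_wreath)
      then show False using \<pi>(2) insert by simp
    qed
    then show ?thesis using False insert by blast
  qed
qed simp


section \<open>Universal polynomial groups\<close>

definition pol_map :: "nat \<Rightarrow> ('a, 'b) monoid_scheme \<Rightarrow> 'a \<Rightarrow> ('a \<times> bool) list set" where
  "pol_map s G g = normal_closure (pol_free G) (pol_relators s G) #>\<^bsub>pol_free G\<^esub> pol_iota G g"

text \<open>Both claims share one induction, since preservation of products and inverses presupposes
  that the arguments lie in the carrier.\<close>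

lemma hom_group_diffs:
  assumes "group G" "group_hom H K \<psi>" "\<And>g. g \<in> carrier G \<Longrightarrow> f g \<in> carrier H"
    and "\<And>g. g \<in> carrier G \<Longrightarrow> \<psi> (f g) = q g" "set gs \<subseteq> carrier G" "x \<in> carrier G"
  shows "group_diffs G H gs f x \<in> carrier H \<and> \<psi> (group_diffs G H gs f x) = group_diffs G K gs q x"
  using assms(5,6)
proof (induction gs arbitrary: x)
  case Nil
  then show ?case using assms by (simp add: group_diffs_def)
next
  case (Cons g gs)
  interpret \<psi>: group_hom H K \<psi> by fact
  interpret A: group G by fact
  show ?case
    using Cons.IH[of x] Cons.IH[of "g \<otimes>\<^bsub>G\<^esub> x"] Cons.prems
    by (simp add: group_diffs_def group_diff_def)
qed

section \<open>The presentation of \<open>Pol\<close> and its universal property\<close>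

locale pol = G: group G for G :: "('a, 'b) monoid_scheme" +
  fixes s :: nat
begin

abbreviation "\<F> \<equiv> pol_free G"
abbreviation "\<R> \<equiv> normal_closure \<F> (pol_relators s G)"

sublocale F: group \<F>
  unfolding pol_free_def by (rule group_free_group)

lemma normal_\<R>: "\<R> \<lhd> \<F>"
  by (intro normal_normal_closure F.group_axioms pol_relators_closed G.group_axioms)

sublocale P: group "Pol s G"
  by (intro group_Pol G.group_axioms)

definition \<nu> :: "('a \<times> bool) list \<Rightarrow> ('a \<times> bool) list set" where
  "\<nu> w = \<R> #>\<^bsub>\<F>\<^esub> w"

sublocale \<nu>: group_hom \<F> "Pol s G" \<nu>
  using normal.r_coset_hom_Mod[OF normal_\<R>]
  by unfold_locales (simp add: \<nu>_def[abs_def] Pol_def)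

lemma carrier_Pol: "carrier (Pol s G) = \<nu> ` carrier \<F>"
  by (simp add: Pol_def carrier_FactGroup \<nu>_def)

lemma pol_iota_closed: "g \<in> carrier G \<Longrightarrow> pol_iota G g \<in> carrier \<F>"
  using F.one_closed free_gen_closed[of g "carrier G - {\<one>\<^bsub>G\<^esub>}"] by (simp add: pol_iota_def pol_free_def)

lemma pol_map_eq: "pol_map s G g = \<nu> (pol_iota G g)"
  by (simp add: pol_map_def \<nu>_def)

lemma pol_map_one: "pol_map s G \<one>\<^bsub>G\<^esub> = \<one>\<^bsub>Pol s G\<^esub>"
  by (simp add: pol_map_eq pol_iota_def)

lemma pol_map_closed: "g \<in> carrier G \<Longrightarrow> pol_map s G g \<in> carrier (Pol s G)"
  by (simp add: pol_map_eq pol_iota_closed)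

lemma group_diffs_pol_map:
  assumes "set gs \<subseteq> carrier G" "length gs = s + 1"
  shows "group_diffs G (Pol s G) gs (pol_map s G) \<one>\<^bsub>G\<^esub> = \<one>\<^bsub>Pol s G\<^esub>"
proof -
  let ?r = "group_diffs G \<F> gs (pol_iota G) \<one>\<^bsub>G\<^esub>"
  have "?r \<in> pol_relators s G" using assms by (auto simp: pol_relators_def)
  then have "?r \<in> \<R>" by (auto simp: normal_closure_def)
  then have "\<nu> ?r = \<one>\<^bsub>Pol s G\<^esub>"
    using normal.axioms(1)[OF normal_\<R>] F.group_axioms
    by (simp add: \<nu>_def Pol_def subgroup.rcos_const)
  then show ?thesis
    using hom_group_diffs[OF G.group_axioms \<nu>.group_hom_axioms pol_iota_closed pol_map_eq[symmetric] assms(1) G.one_closed]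
    by simp
qed

text \<open>The map extends to the free group; its kernel is normal and contains the relators, hence
  their normal closure, so the extension factors through the quotient.\<close>

lemma pol_universal:
  assumes K: "group K" and q: "\<And>g. g \<in> carrier G \<Longrightarrow> q g \<in> carrier K" "q \<one>\<^bsub>G\<^esub> = \<one>\<^bsub>K\<^esub>"
    and diffs: "\<And>gs. set gs \<subseteq> carrier G \<Longrightarrow> length gs = s + 1 \<Longrightarrow> group_diffs G K gs q \<one>\<^bsub>G\<^esub> = \<one>\<^bsub>K\<^esub>"
  shows "\<exists>\<psi>\<in>hom (Pol s G) K. \<forall>g\<in>carrier G. \<psi> (pol_map s G g) = q g"
proof -
  obtain h where h: "h \<in> hom \<F> K" "\<And>a. a \<in> carrier G - {\<one>\<^bsub>G\<^esub>} \<Longrightarrow> h (free_gen a) = q a"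
    using free_group_universal[OF K, of q "carrier G - {\<one>\<^bsub>G\<^esub>}"] q by (auto simp: pol_free_def)
  interpret K: group K by fact
  interpret h: group_hom \<F> K h using h(1) by unfold_locales
  have hq: "h (pol_iota G g) = q g" if "g \<in> carrier G" for g
    using that h(2) q(2) by (simp add: pol_iota_def)
  have "pol_relators s G \<subseteq> kernel \<F> K h"
  proof
    fix r assume "r \<in> pol_relators s G"
    then obtain gs where gs: "set gs \<subseteq> carrier G" "length gs = s + 1" "r = group_diffs G \<F> gs (pol_iota G) \<one>\<^bsub>G\<^esub>"
      by (auto simp: pol_relators_def)
    then show "r \<in> kernel \<F> K h"
      using hom_group_diffs[OF G.group_axioms h.group_hom_axioms pol_iota_closed hq gs(1) G.one_closed] diffs
      by (simp add: kernel_def)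
  qed
  then have sub: "\<R> \<subseteq> kernel \<F> K h"
    unfolding normal_closure_def using h.normal_kernel by blast
  have "h x = h y" if "x \<in> carrier \<F>" "y \<in> carrier \<F>" "\<R> #>\<^bsub>\<F>\<^esub> x = \<R> #>\<^bsub>\<F>\<^esub> y" for x y
  proof -
    have "x \<in> \<R> #>\<^bsub>\<F>\<^esub> y" using that F.rcos_self[of x \<R>] normal_imp_subgroup[OF normal_\<R>] by blast
    then obtain r where "r \<in> \<R>" "x = r \<otimes>\<^bsub>\<F>\<^esub> y" by (auto simp: r_coset_def)
    then show ?thesis using sub that by (auto simp: kernel_def)
  qed
  then obtain \<psi> where "\<psi> \<in> hom (\<F> Mod \<R>) K" "\<And>x. x \<in> carrier \<F> \<Longrightarrow> \<psi> (\<R> #>\<^bsub>\<F>\<^esub> x) = h x"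
    using FactGroup_universal[OF h(1) normal_\<R>] by metis
  then show ?thesis
    using hq pol_iota_closed by (intro bexI[of _ \<psi>]) (auto simp: Pol_def pol_map_def)
qed

text \<open>Represent the element by a reduced word and peel off letters from the left; the two
  signs of a letter give the two generator cases.\<close>

lemma pol_induct [consumes 1, case_names one gen inv_gen]:
  assumes "w \<in> carrier (Pol s G)"
    and one: "\<one>\<^bsub>Pol s G\<^esub> \<in> S"
    and gen: "\<And>g v. g \<in> carrier G \<Longrightarrow> v \<in> S \<Longrightarrow> pol_map s G g \<otimes>\<^bsub>Pol s G\<^esub> v \<in> S"
    and inv_gen: "\<And>g v. g \<in> carrier G \<Longrightarrow> v \<in> S \<Longrightarrow> inv\<^bsub>Pol s G\<^esub> pol_map s G g \<otimes>\<^bsub>Pol s G\<^esub> v \<in> S"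
  shows "w \<in> S"
proof -
  obtain u where u: "u \<in> carrier \<F>" "w = \<nu> u" using assms(1) carrier_Pol by auto
  have "\<nu> u \<in> S" using u(1)
  proof (induction u)
    case Nil
    have "[] = \<one>\<^bsub>\<F>\<^esub>" by (simp add: pol_free_def free_group_def)
    then have "\<nu> [] = \<one>\<^bsub>Pol s G\<^esub>" using \<nu>.hom_one by metis
    then show ?case using one by simp
  next
    case (Cons x u)
    obtain a e where x: "x = (a, e)" by (cases x)
    have a: "a \<in> carrier G" "a \<noteq> \<one>\<^bsub>G\<^esub>" and u: "u \<in> carrier \<F>" and red: "reduced_word (x # u)"
      using Cons.prems reduced_tl x by (auto simp: pol_free_def free_group_def)
    have i: "pol_iota G a = [(a, True)]" using a by (simp add: pol_iota_def free_gen_def)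
    have ic: "[(a, e)] \<in> carrier \<F>" using a by (simp add: pol_free_def free_group_def reduced_word_def)
    \<comment> \<open>As \<open>x # u\<close> is reduced, nothing cancels and multiplying by the
      letter just prepends it.\<close>
    have "[(a, e)] \<otimes>\<^bsub>\<F>\<^esub> u = x # u"
      using reduced_Cons_push[OF red] x by (simp add: pol_free_def free_group_def)
    then have "\<nu> (x # u) = \<nu> [(a, e)] \<otimes>\<^bsub>Pol s G\<^esub> \<nu> u" using \<nu>.hom_mult[OF ic u] by simp
    moreover have "[(a, False)] = inv\<^bsub>\<F>\<^esub> pol_iota G a"
      using a by (intro F.inv_equality[symmetric] pol_iota_closed)
        (auto simp: pol_free_def free_group_def reduced_word_def i pol_iota_def free_gen_def)
    then have "\<nu> [(a, False)] = inv\<^bsub>Pol s G\<^esub> pol_map s G a"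
      using pol_iota_closed[OF a(1)] by (simp add: pol_map_eq)
    moreover have "\<nu> [(a, True)] = pol_map s G a" by (simp add: pol_map_eq i)
    ultimately show ?case using gen inv_gen a(1) Cons.IH[OF u] by (cases e) auto
  qed
  then show ?thesis using u by simp
qed

lemma countable_Pol:
  assumes "countable (carrier G)"
  shows "countable (carrier (Pol s G))"
proof -
  have "countable (lists ((carrier G - {\<one>\<^bsub>G\<^esub>}) \<times> (UNIV :: bool set)))"
    using assms by (intro countable_lists countable_SIGMA) auto
  then have "countable (carrier \<F>)"
    by (rule countable_subset[rotated]) (auto simp: pol_free_def free_group_def)
  then show ?thesis by (simp add: carrier_Pol)
qed

end

section \<open>Separation of the elements of \<open>Pol 2 G\<close> by wreath products\<close>

lemma Pol_2_to_wreath: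
  assumes "group G" "comm_group B" "\<pi> \<in> hom G B"
  shows "\<exists>\<psi>\<in>hom (Pol 2 G) (wreath B G). \<forall>g\<in>carrier G. \<psi> (pol_map 2 G g) = wreath_gen B G \<pi> g"
proof -
  interpret G: group G by fact
  interpret B: comm_group B by fact
  interpret wreath_quadratic B G \<pi> using assms(3) by unfold_locales
  interpret pol G 2 by unfold_locales
  show ?thesis
  proof (intro pol_universal group_wreath q_closed q_one)
    fix gs assume "set gs \<subseteq> carrier G" "length gs = 2 + 1"
    then obtain k g h where "gs = [k, g, h]" "k \<in> carrier G" "g \<in> carrier G" "h \<in> carrier G"
      by (auto simp: numeral_eq_Suc length_Suc_conv)
    then show "group_diffs G (wreath B G) gs (wreath_gen B G \<pi>) \<one>\<^bsub>G\<^esub> = \<one>\<^bsub>wreath B G\<^esub>"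
      by (simp only: q_diff3)
  qed auto
qed

lemma quadratic_pol_map:
  assumes "group G"
  shows "quadratic_map G (Pol 2 G) (pol_map 2 G)"
proof -
  interpret G: group G by fact
  interpret pol G 2 by unfold_locales
  show ?thesis
    by unfold_locales (auto simp: pol_map_closed pol_map_one group_diffs_pol_map)
qed

text \<open>Write \<open>w\<close> as a normal form \<open>n\<close> times the image of some
  \<open>g\<close>. A nontrivial \<open>g\<close> is visible in the coordinate in \<open>G\<close>;
  for trivial \<open>g\<close> a lamp of \<open>n\<close> has to be detected.\<close>

lemma Pol_2_separate:
  fixes G :: "('a, 'b) monoid_scheme"
  assumes "group G" "w \<in> carrier (Pol 2 G)" "w \<noteq> \<one>\<^bsub>Pol 2 G\<^esub>"
  shows "\<exists>(B :: 'a set set monoid) \<psi>. comm_group B \<and> (\<forall>b\<in>carrier B. \<exists>n>0. b [^]\<^bsub>B\<^esub> (n::nat) = \<one>\<^bsub>B\<^esub>) \<and>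
    \<psi> \<in> hom (Pol 2 G) (wreath B G) \<and> \<psi> w \<noteq> \<one>\<^bsub>wreath B G\<^esub>"
proof -
  interpret G: group G by fact
  interpret pol G 2 by unfold_locales
  interpret quadratic_map G "Pol 2 G" "pol_map 2 G" using quadratic_pol_map[OF assms(1)] .
  have "w \<in> span" using assms(2)
    by (induction rule: pol_induct) (auto intro: one_in_span span_f span_f_inv)
  then obtain E n g where w: "w = n \<otimes>\<^bsub>Pol 2 G\<^esub> pol_map 2 G g" "nf E n" "g \<in> carrier G"
    by (auto simp: span_def)
  have n: "n \<in> carrier (Pol 2 G)" using nf_closed w(2) .
  \<comment> \<open>The condition on \<pi> is guarded by
    \<open>a \<notin> derived G (carrier G)\<close>, the form in which
    \<open>torsion_abelian_quotient\<close> delivers it, so one construction serves both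
    cases.\<close>
  obtain a where a: "a \<in> carrier G" and sep: "\<And>(B :: 'a set set monoid) \<pi> \<psi>. comm_group B \<Longrightarrow> \<pi> \<in> hom G B \<Longrightarrow>
      (a \<notin> derived G (carrier G) \<longrightarrow> \<pi> a \<noteq> \<one>\<^bsub>B\<^esub>) \<Longrightarrow> \<psi> \<in> hom (Pol 2 G) (wreath B G) \<Longrightarrow>
      \<forall>g\<in>carrier G. \<psi> (pol_map 2 G g) = wreath_gen B G \<pi> g \<Longrightarrow> \<psi> w \<noteq> \<one>\<^bsub>wreath B G\<^esub>"
  proof (cases "g = \<one>\<^bsub>G\<^esub>")
    case True
    then have "w = n" using w n by simp
    then have n1: "nf E w" "w \<noteq> \<one>\<^bsub>Pol 2 G\<^esub>" using assms(3) w(2) by auto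
    obtain a where "a \<in> carrier G - derived G (carrier G)"
      "\<forall>(B :: 'a set set monoid) \<pi> \<psi>. comm_group B \<longrightarrow> \<pi> \<in> hom G B \<longrightarrow> \<pi> a \<noteq> \<one>\<^bsub>B\<^esub> \<longrightarrow>
        \<psi> \<in> hom (Pol 2 G) (wreath B G) \<longrightarrow>
        (\<forall>g\<in>carrier G. \<psi> (pol_map 2 G g) = wreath_gen B G \<pi> g) \<longrightarrow> \<psi> w \<noteq> \<one>\<^bsub>wreath B G\<^esub>"
      using nf_separate[OF n1] by (rule bexE)
    then show ?thesis by (intro that[of a]) auto
  next
    case False
    have "\<psi> w \<noteq> \<one>\<^bsub>wreath B G\<^esub>"
      if B: "comm_group B" and \<pi>: "\<pi> \<in> hom G B" and \<psi>: "\<psi> \<in> hom (Pol 2 G) (wreath B G)"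
        "\<forall>g\<in>carrier G. \<psi> (pol_map 2 G g) = wreath_gen B G \<pi> g" for B :: "'a set set monoid" and \<pi> \<psi>
    proof -
      interpret B: comm_group B by fact
      interpret wreath_quadratic B G \<pi> using \<pi> by unfold_locales
      have "\<psi> w = \<psi> n \<otimes>\<^bsub>wreath B G\<^esub> wreath_gen B G \<pi> g"
        using \<psi> w n pol_map_closed by (auto simp: hom_mult)
      moreover have "snd (\<psi> n) = \<one>\<^bsub>G\<^esub>"
        using hom_nf[OF quadratic_map_axioms \<psi>(1) _ w(2)] \<psi>(2) by simp
      ultimately have "snd (\<psi> w) = g"
        using w by (cases "\<psi> n") (simp add: wreath_gen_def mult_wreath)
      then show ?thesis using False by (auto simp: one_wreath)
    qed
    \<comment> \<open>Separation takes place in the coordinate in \<open>G\<close> whatever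
      \<open>B\<close> and \<pi> are, and \<one> is a placeholder for \<open>a\<close>.\<close>
    then show ?thesis by (intro that[of "\<one>\<^bsub>G\<^esub>"]) auto
  qed
  obtain B :: "'a set set monoid" and \<pi> where B: "comm_group B"
    "\<forall>b\<in>carrier B. \<exists>n>0. b [^]\<^bsub>B\<^esub> (n::nat) = \<one>\<^bsub>B\<^esub>"
    "\<pi> \<in> hom G B" "a \<notin> derived G (carrier G) \<longrightarrow> \<pi> a \<noteq> \<one>\<^bsub>B\<^esub>"
    using torsion_abelian_quotient[OF assms(1) a] by blast
  obtain \<psi> where "\<psi> \<in> hom (Pol 2 G) (wreath B G)"
    "\<forall>g\<in>carrier G. \<psi> (pol_map 2 G g) = wreath_gen B G \<pi> g"
    using Pol_2_to_wreath[OF assms(1) B(1,3)] by blast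
  then show ?thesis using B sep by blast
qed

theorem proposition5p3:
  fixes G :: "('a, 'b) monoid_scheme"
  assumes "sofic G"
  shows "sofic (Pol 2 G)"
proof (rule locally_sofic_imp_sofic)
  have G: "group G" "countable (carrier G)" "locally_sofic G"
    using assms sofic_imp_locally_sofic by (auto simp: sofic_def)
  interpret G: group G by fact
  interpret pol G 2 by unfold_locales
  show "group (Pol 2 G)" by (rule P.group_axioms)
  show "countable (carrier (Pol 2 G))" by (rule countable_Pol[OF G(2)])
  show "locally_sofic (Pol 2 G)"
  proof (rule locally_sofic_if_residually[OF P.group_axioms])
    fix E w and \<epsilon> :: real
    assume E: "finite E" "E \<subseteq> carrier (Pol 2 G)" and w: "w \<in> carrier (Pol 2 G)" "w \<noteq> \<one>\<^bsub>Pol 2 G\<^esub>"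
      and \<epsilon>: "\<epsilon> > 0"
    obtain B :: "'a set set monoid" and \<psi> where B: "comm_group B"
      "\<forall>b\<in>carrier B. \<exists>n>0. b [^]\<^bsub>B\<^esub> (n::nat) = \<one>\<^bsub>B\<^esub>"
      and \<psi>: "\<psi> \<in> hom (Pol 2 G) (wreath B G)" "\<psi> w \<noteq> \<one>\<^bsub>wreath B G\<^esub>"
      using Pol_2_separate[OF G(1) w] by blast
    have "locally_sofic (wreath B G)" using B G by (intro locally_sofic_wreath) auto
    moreover have "\<psi> ` E \<subseteq> carrier (wreath B G)" "\<psi> ` {w} \<subseteq> carrier (wreath B G) - {\<one>\<^bsub>wreath B G\<^esub>}"
      using \<psi> E w by (auto simp: hom_def)
    \<comment> \<open>The wreath product is approximated on the images of \<open>E\<close> and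
      \<open>w\<close>; nontriviality of \<open>\<psi> w\<close> is what allows displacement to be
      demanded there.\<close>
    ultimately obtain m \<rho> where m: "m > (0::nat)" "perm_approx (wreath B G) (\<psi> ` E) (\<psi> ` {w}) \<epsilon> {1..m} \<rho>"
      unfolding locally_sofic_def using E \<epsilon> by (meson finite_imageI finite.emptyI finite.insertI)
    then show "\<exists>m>0. \<exists>\<rho>. perm_approx (Pol 2 G) E {w} \<epsilon> {1..m::nat} \<rho>"
      using perm_approx_hom[OF \<psi>(1) m(2) E(2)] by blast
  qed
qed

end
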